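(* Let $V=\{(x_1^*,\dots,x_5^*,x^*,y^* )\in\mathbb{R}^7: x_4^*x_5^*\neq 0\}$ and, for each $G\in\{G_2,G_3,G_4^{00},G_9,G_{10}^{\lambda}\ (\lambda\in\mathbb{R})\}$, let $(V,\mathcal{F}_G)$ be the GMD-foliation associated to $G$, i.e. the foliation of $V$ whose leaves are the coadjoint orbits $\Omega_F$ of $G$ through points $F\in V$. Then: (1) All the GMD-foliations $(V,\mathcal{F}_{G_2})$, $(V,\mathcal{F}_{G_3})$, $(V,\mathcal{F}_{G_4^{00}})$, $(V,\mathcal{F}_{G_9})$, $(V,\mathcal{F}_{G_{10}^{\lambda}})$ ($\lambda\in\mathbb{R}$) are topologically equivalent to one another; in other words, there is only one topological type of GMD-foliations. (2) Every GMD-foliation is a trivial fibration with connected fibers over the disjoint (discrete) union $\mathbb{R}\sqcup\mathbb{R}\sqcup\mathbb{R}\sqcup\mathbb{R}$ of four copies of the real line, i.e. its leaves are the (connected) fibers of a trivial fibration of $V$ over $\mathbb{R}\sqcup\mathbb{R}\sqcup\mathbb{R}\sqcup\mathbb{R}$.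
   Context: Each Lie algebra below is a $7$-dimensional real Lie algebra with basis $(X_1,X_2,X_3,X_4,X_5,X,Y)$. In all of them $[X_1,X_2]=X_4$, $[X_1,X_3]=X_5$, $[X,Y]=0$. The remaining non-zero brackets (up to antisymmetry) are: - $\mathcal{G}_2$: $[X,X_1]=X_1,\ [X,X_4]=X_4,\ [X,X_5]=X_5,\ [Y,X_3]=X_3,\ [Y,X_5]=X_5$. - $\mathcal{G}_3$: $[X,X_2]=X_2,\ [X,X_4]=X_4,\ [Y,X_3]=X_3,\ [Y,X_5]=X_5$. - $\mathcal{G}_4^{00}$: $[X,X_1]=X_1,\ [X,X_4]=X_4,\ [X,X_5]=X_5,\ [Y,X_2]=X_2,\ [Y,X_4]=X_4$. - $\mathcal{G}_9$: $[X,X_3]=X_3,\ [X,X_5]=X_5,\ [Y,X_2]=X_2,\ [Y,X_4]=X_4,\ [Y,X_3]=X_5$. - $\mathcal{G}_{10}^{\lambda}$ ($\lambda\in\mathbb{R}$): $[X,X_2]=X_2,\ [X,X_3]=\lambda X_3,\ [X,X_4]=X_4,\ [X,X_5]=\lambda X_5,\ [Y,X_3]=X_3+X_5,\ [Y,X_5]=X_5$. $G_2,G_3,G_4^{00},G_9,G_{10}^{\lambda}$ denote the corresponding connected and simply connected real Lie groups. For each of them, $\mathcal{G}^*$ is identified with $\mathbb{R}^7$ by the coordinates $(x_1^*,\dots,x_5^*,x^*,y^* )$ with respect to the dual basis $(X_1^*,\dots,X_5^*,X^*,Y^* )$, so that $V$ is an open subset of $\mathcal{G}^*$. The coadjoint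 representation is $\langle K(g)F,Z\rangle=\langle F,\mathrm{Ad}(g^{-1})Z\rangle$ and $\Omega_F=\{K(g)F:g\in G\}$. For each such $G$, the coadjoint orbits through points of $V$ are contained in $V$, are $6$-dimensional and are the leaves of a smooth $6$-dimensional foliation of $V$, denoted $(V,\mathcal{F}_G)$ and called the generalized MD-foliation (GMD-foliation) associated to $G$. Two foliations $(V_1,\mathcal{F}_1)$, $(V_2,\mathcal{F}_2)$ are topologically equivalent if there is a homeomorphism $h:V_1\to V_2$ sending each leaf of $\mathcal{F}_1$ onto a leaf of $\mathcal{F}_2$. *)

theory Defs
  imports "HOL-Analysis.Analysis" "HOL-Algebra.Group"
begin

section \<open>Lie groups\<close>

text \<open>Only used on open sets \<open>S\<close>, where \<open>C\<^sup>k\<close> in the sense of iterated directional derivatives of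
  differentiable maps is the usual notion.\<close>

primrec Ck_on :: "nat \<Rightarrow> 'a::euclidean_space set \<Rightarrow> ('a \<Rightarrow> 'b::euclidean_space) \<Rightarrow> bool" where
  "Ck_on 0 S f \<longleftrightarrow> continuous_on S f"
| "Ck_on (Suc k) S f \<longleftrightarrow>
     f differentiable_on S \<and> (\<forall>v. Ck_on k S (\<lambda>x. frechet_derivative f (at x) v))"

definition smooth_on :: "'a::euclidean_space set \<Rightarrow> ('a \<Rightarrow> 'b::euclidean_space) \<Rightarrow> bool" where
  "smooth_on S f \<longleftrightarrow> (\<forall>k. Ck_on k S f)"

text \<open>The group \<open>G\<close> carries the subspace topology of its ambient Hausdorff, second countable type.
  A chart is a pair \<open>(U, \<phi>)\<close> of a domain and a coordinate map; \<open>inv_into U \<phi>\<close> is the inverse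
  parametrisation. The model space is an arbitrary Euclidean space. Continuity of the group
  operations makes the coordinate domains below open.\<close>

locale lie_group = group G
  for G :: "'g::{t2_space, second_countable_topology} monoid" (structure)
    and atlas :: "('g set \<times> ('g \<Rightarrow> 'a::euclidean_space)) set" +
  assumes chart_domain: "(U, \<phi>) \<in> atlas \<Longrightarrow> openin (top_of_set (carrier G)) U"
    and chart_range: "(U, \<phi>) \<in> atlas \<Longrightarrow> open (\<phi> ` U)"
    and chart_homeomorphism: "(U, \<phi>) \<in> atlas \<Longrightarrow> homeomorphism U (\<phi> ` U) \<phi> (inv_into U \<phi>)"
    and charts_cover: "(\<Union>(U, \<phi>) \<in> atlas. U) = carrier G"
    and charts_compatible: "\<lbrakk>(U, \<phi>) \<in> atlas; (W, \<psi>) \<in> atlas\<rbrakk> \<Longrightarrow>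
          smooth_on (\<phi> ` (U \<inter> W)) (\<lambda>x. \<psi> (inv_into U \<phi> x))"
    and mult_continuous: "continuous_on (carrier G \<times> carrier G) (\<lambda>(g, h). g \<otimes> h)"
    and mult_smooth: "\<lbrakk>(U, \<phi>) \<in> atlas; (W, \<psi>) \<in> atlas; (Z, \<xi>) \<in> atlas\<rbrakk> \<Longrightarrow>
          smooth_on {(\<phi> g, \<psi> h) | g h. g \<in> U \<and> h \<in> W \<and> g \<otimes> h \<in> Z}
            (\<lambda>(x, y). \<xi> (inv_into U \<phi> x \<otimes> inv_into W \<psi> y))"
    and inverse_continuous: "continuous_on (carrier G) (m_inv G)"
    and inverse_smooth: "\<lbrakk>(U, \<phi>) \<in> atlas; (W, \<psi>) \<in> atlas\<rbrakk> \<Longrightarrow>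
          smooth_on {\<phi> g | g. g \<in> U \<and> m_inv G g \<in> W}
            (\<lambda>x. \<psi> (m_inv G (inv_into U \<phi> x)))"
begin

text \<open>The tangent space at the identity is the model space \<open>'a\<close>, through a chart around \<open>\<one>\<close> chosen
  once and for all; another choice changes \<open>Ad\<close> and \<open>lie_bracket\<close> by a linear isomorphism.\<close>

definition id_chart :: "'g set \<times> ('g \<Rightarrow> 'a)" where
  "id_chart = (SOME c. c \<in> atlas \<and> \<one> \<in> fst c)"

definition to_coord :: "'g \<Rightarrow> 'a" where
  "to_coord = snd id_chart"

definition of_coord :: "'a \<Rightarrow> 'g" where
  "of_coord = inv_into (fst id_chart) to_coord"

text \<open>\<open>Ad g\<close> is the differential at \<open>\<one>\<close> of conjugation by \<open>g\<close>, and the bracket of the Lie algebra is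
  \<open>[u, v] = ad u v\<close>, where \<open>ad\<close> is the differential of \<open>Ad\<close> at \<open>\<one>\<close>.\<close>

definition Ad :: "'g \<Rightarrow> 'a \<Rightarrow> 'a" where
  "Ad g v = frechet_derivative (\<lambda>x. to_coord (g \<otimes> of_coord x \<otimes> m_inv G g)) (at (to_coord \<one>)) v"

definition lie_bracket :: "'a \<Rightarrow> 'a \<Rightarrow> 'a" where
  "lie_bracket u v = frechet_derivative (\<lambda>x. Ad (of_coord x) v) (at (to_coord \<one>)) u"

text \<open>\<open>\<iota>\<close> identifies the Lie algebra given by a bracket on \<open>\<real>\<^sup>n\<close> with the Lie algebra of \<open>G\<close>.\<close>

definition has_lie_algebra ::
    "(real^'n \<Rightarrow> 'a) \<Rightarrow> (real^'n \<Rightarrow> real^'n \<Rightarrow> real^'n) \<Rightarrow> bool" where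
  "has_lie_algebra \<iota> br \<longleftrightarrow>
     linear \<iota> \<and> bij \<iota> \<and> (\<forall>u v. \<iota> (br u v) = lie_bracket (\<iota> u) (\<iota> v))"

text \<open>A form \<open>F\<close> is given by its coordinates in the dual basis, so that \<open>\<langle>F, Z\<rangle> = F \<bullet> Z\<close>;
  thus \<open>\<langle>K(g)F, Z\<rangle> = \<langle>F, Ad(g\<inverse>)Z\<rangle>\<close>, evaluated on the basis vectors \<open>Z\<close>.\<close>

definition coadjoint :: "(real^'n \<Rightarrow> 'a) \<Rightarrow> 'g \<Rightarrow> real^'n \<Rightarrow> real^'n" where
  "coadjoint \<iota> g F = (\<chi> i. F \<bullet> inv_into UNIV \<iota> (Ad (m_inv G g) (\<iota> (axis i 1))))"

definition coadjoint_orbit :: "(real^'n \<Rightarrow> 'a) \<Rightarrow> real^'n \<Rightarrow> (real^'n) set" where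
  "coadjoint_orbit \<iota> F = {coadjoint \<iota> g F | g. g \<in> carrier G}"

end

section \<open>The Lie algebras\<close>

text \<open>Coordinates \<open>1, \<dots>, 5\<close> belong to \<open>X\<^sub>1, \<dots>, X\<^sub>5\<close>, coordinate \<open>6\<close> to \<open>X\<close> and \<open>7\<close> to \<open>Y\<close>
  (in the index type \<open>7\<close> the numeral \<open>7\<close> equals \<open>0\<close>, and \<open>1, \<dots>, 7\<close> are its distinct elements).
  An entry \<open>(i, j, w)\<close> stands for \<open>[bv i, bv j] = w = - [bv j, bv i]\<close>; brackets of basis vectors not
  listed are zero.\<close>

abbreviation bv :: "7 \<Rightarrow> real^7" where
  "bv i \<equiv> axis i 1"

definition bracket_of :: "(7 \<times> 7 \<times> (real^7)) list \<Rightarrow> real^7 \<Rightarrow> real^7 \<Rightarrow> real^7" where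
  "bracket_of tab u v = (\<Sum>(i, j, w) \<leftarrow> tab. (u $ i * v $ j - u $ j * v $ i) *\<^sub>R w)"

definition g2 :: "real^7 \<Rightarrow> real^7 \<Rightarrow> real^7" where
  "g2 = bracket_of [(1, 2, bv 4), (1, 3, bv 5),
     (6, 1, bv 1), (6, 4, bv 4), (6, 5, bv 5), (7, 3, bv 3), (7, 5, bv 5)]"

definition g3 :: "real^7 \<Rightarrow> real^7 \<Rightarrow> real^7" where
  "g3 = bracket_of [(1, 2, bv 4), (1, 3, bv 5),
     (6, 2, bv 2), (6, 4, bv 4), (7, 3, bv 3), (7, 5, bv 5)]"

definition g4_00 :: "real^7 \<Rightarrow> real^7 \<Rightarrow> real^7" where
  "g4_00 = bracket_of [(1, 2, bv 4), (1, 3, bv 5),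
     (6, 1, bv 1), (6, 4, bv 4), (6, 5, bv 5), (7, 2, bv 2), (7, 4, bv 4)]"

definition g9 :: "real^7 \<Rightarrow> real^7 \<Rightarrow> real^7" where
  "g9 = bracket_of [(1, 2, bv 4), (1, 3, bv 5),
     (6, 3, bv 3), (6, 5, bv 5), (7, 2, bv 2), (7, 4, bv 4), (7, 3, bv 5)]"

definition g10 :: "real \<Rightarrow> real^7 \<Rightarrow> real^7 \<Rightarrow> real^7" where
  "g10 l = bracket_of [(1, 2, bv 4), (1, 3, bv 5),
     (6, 2, bv 2), (6, 3, l *\<^sub>R bv 3), (6, 4, bv 4), (6, 5, l *\<^sub>R bv 5),
     (7, 3, bv 3 + bv 5), (7, 5, bv 5)]"

definition gmd_algebras :: "(real^7 \<Rightarrow> real^7 \<Rightarrow> real^7) set" where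
  "gmd_algebras = {g2, g3, g4_00, g9} \<union> range g10"

section \<open>Foliations\<close>

text \<open>A foliation is recorded by the underlying space and the set of its leaves.\<close>

type_synonym 'a foliation = "'a set \<times> 'a set set"

definition topologically_equivalent ::
    "'a::topological_space foliation \<Rightarrow> 'b::topological_space foliation \<Rightarrow> bool" where
  "topologically_equivalent = (\<lambda>(V1, F1) (V2, F2).
     \<exists>h k. homeomorphism V1 V2 h k \<and> (\<forall>L \<in> F1. h ` L \<in> F2))"

definition V :: "(real^7) set" where
  "V = {F. F $ 4 * F $ 5 \<noteq> 0}"

text \<open>\<open>gmd_group G atlas \<iota> br\<close>: \<open>G\<close> is a connected and simply connected Lie group whose Lie algebra
  is identified by \<open>\<iota>\<close> with \<open>\<real>\<^sup>7\<close> under the bracket \<open>br\<close>.\<close>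

definition gmd_group :: "'g::{t2_space, second_countable_topology} monoid \<Rightarrow>
    ('g set \<times> ('g \<Rightarrow> 'a::euclidean_space)) set \<Rightarrow> (real^7 \<Rightarrow> 'a) \<Rightarrow>
    (real^7 \<Rightarrow> real^7 \<Rightarrow> real^7) \<Rightarrow> bool" where
  "gmd_group G atlas \<iota> br \<longleftrightarrow>
     br \<in> gmd_algebras \<and> lie_group G atlas \<and>
     connected (carrier G) \<and> simply_connected (carrier G) \<and>
     lie_group.has_lie_algebra G atlas \<iota> br"

definition gmd_foliation :: "'g::{t2_space, second_countable_topology} monoid \<Rightarrow>
    ('g set \<times> ('g \<Rightarrow> 'a::euclidean_space)) set \<Rightarrow> (real^7 \<Rightarrow> 'a) \<Rightarrow> (real^7) foliation" where
  "gmd_foliation G atlas \<iota> = (V, {lie_group.coadjoint_orbit G atlas \<iota> F | F. F \<in> V})"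

section \<open>Trivial fibrations\<close>

text \<open>The fibre may be taken on the type of the total space, because the fibre of a trivial
  fibration over a nonempty base is homeomorphic to a subspace of the total space.\<close>

definition trivial_fibration :: "'a topology \<Rightarrow> 'b topology \<Rightarrow> ('a \<Rightarrow> 'b) \<Rightarrow> bool" where
  "trivial_fibration E B p \<longleftrightarrow>
     (\<exists>(F :: 'a topology) \<Phi>. topspace F \<noteq> {} \<and> homeomorphic_map E (prod_topology B F) \<Phi> \<and>
        (\<forall>x \<in> topspace E. fst (\<Phi> x) = p x))"

definition four_lines :: "(nat \<times> real) topology" where
  "four_lines = sum_topology (\<lambda>_. euclidean) {..<4}"

end

theory Submission
  imports Defs
begin

text \<open>
Write \<open>x\<^sub>i\<close> for the coordinates on the dual of the algebra. For each of the algebras there is a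
function \<open>P\<close> on \<open>V\<close>, affine in \<open>x\<^sub>2\<close> with nowhere vanishing slope, whose level sets inside the four
quadrants \<open>\<plusminus>x\<^sub>4 > 0, \<plusminus>x\<^sub>5 > 0\<close> are exactly the coadjoint orbits in \<open>V\<close>. For example
\<open>P = x\<^sub>3 / x\<^sub>5 - x\<^sub>2 / x\<^sub>4\<close> for \<open>g3\<close>; the other invariants arise from it by a factor or by logarithms of
\<open>\<bar>x\<^sub>4\<bar>\<close> and \<open>\<bar>x\<^sub>5\<bar>\<close>. Given this, the topology is immediate: replacing the coordinate \<open>x\<^sub>2\<close> by \<open>P\<close> is a
homeomorphism of \<open>V\<close> onto itself that carries the orbits to the level sets of \<open>x\<^sub>2\<close> in the
quadrants. This model foliation is the same for all algebras, it is a product over four lines, and its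
leaves are convex.

That the orbits are these level sets has two halves. The gradient of \<open>P\<close> at \<open>F\<close> lies in the radical of
the Kirillov form \<open>(u, z) \<mapsto> \<langle>F, [u, z]\<rangle>\<close>, so \<open>P\<close> has zero derivative along the orbits
(\<open>coadj_invariant\<close>); moreover \<open>X\<^sub>4\<close> and \<open>X\<^sub>5\<close> span lines stable under the adjoint representation
(\<open>adj_eigenvector\<close>), so the orbits do not leave \<open>V\<close>, nor their quadrant. Conversely the radical is
a line, no nonzero vector of which has vanishing \<open>X\<^sub>2\<close>-component. So an orbit is open in its level set
(\<open>orbit_thickened_is_neighbourhood\<close>), and since the level set in the quadrant is connected, it is a
single orbit (\<open>coadjoint_orbit_eq_leaf\<close>).

The group is given abstractly, by charts. The proof works in one chart at the identity, where
multiplication is \<open>C\<^sup>2\<close>, and reaches the other elements by connectedness: a connected group is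
generated by each neighbourhood of the identity (\<open>connected_group_induct\<close>). This makes \<open>Ad\<close> a
representation whose derivative at the identity is the bracket, and it makes functions constant whose left derivatives
vanish (\<open>zero_left_derivative_imp_constant\<close>), so that infinitesimal computations in the algebra decide
about orbits of the group.
\<close>

section \<open>Twice differentiable maps\<close>

lemma smooth_on_has_derivative:
  assumes "smooth_on S f" "open S" "x \<in> S"
  shows "(f has_derivative frechet_derivative f (at x)) (at x)"
proof -
  have "Ck_on (Suc 0) S f"
    using assms(1) unfolding smooth_on_def by blast
  then have "f differentiable_on S"
    by simp
  then have "f differentiable (at x)"
    using assms(3) unfolding differentiable_on_def at_within_open[OF assms(3,2), symmetric] by blast
  then show ?thesis
    by (simp add: frechet_derivative_works)
qed

lemma smooth_on_frechet_derivative_differentiable: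
  assumes "smooth_on S f" "open S" "x \<in> S"
  shows "(\<lambda>y. frechet_derivative f (at y) v) differentiable (at x)"
proof -
  have "Ck_on (Suc (Suc 0)) S f"
    using assms(1) unfolding smooth_on_def by blast
  then have "(\<lambda>y. frechet_derivative f (at y) v) differentiable_on S"
    by simp
  then show ?thesis
    using assms(3) unfolding differentiable_on_def at_within_open[OF assms(3,2), symmetric] by blast
qed

text \<open>The derivative of \<open>f\<close> is linear in its direction, so a direction that varies with the point can be
expanded in a basis; this leaves finitely many derivatives in constant directions, which are
differentiable because \<open>f\<close> is \<open>C\<^sup>2\<close>.\<close>

lemma smooth_on_frechet_derivative_apply_differentiable:
  fixes f :: "'a::euclidean_space \<Rightarrow> 'b::euclidean_space"
    and p w :: "'c::real_normed_vector \<Rightarrow> 'a"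
  assumes f: "smooth_on S f" "open S" "p x \<in> S"
    and p: "p differentiable (at x)" and w: "w differentiable (at x)"
  shows "(\<lambda>y. frechet_derivative f (at (p y)) (w y)) differentiable (at x)"
proof -
  have term_diff: "(\<lambda>y. (w y \<bullet> b) *\<^sub>R frechet_derivative f (at (p y)) b) differentiable (at x)" for b
  proof -
    have "(\<lambda>y. frechet_derivative f (at (p y)) b) differentiable (at x)"
      using differentiable_chain_at[OF p smooth_on_frechet_derivative_differentiable[OF f]]
      by (simp add: o_def)
    then obtain D1 where D1: "((\<lambda>y. frechet_derivative f (at (p y)) b) has_derivative D1) (at x)"
      unfolding differentiable_def by blast
    obtain D2 where D2: "(w has_derivative D2) (at x)"
      using w unfolding differentiable_def by blast
    show ?thesis
      using has_derivative_scaleR[OF has_derivative_inner_left[OF D2] D1]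
      unfolding differentiable_def by blast
  qed
  have "(\<lambda>y. \<Sum>b\<in>Basis. (w y \<bullet> b) *\<^sub>R frechet_derivative f (at (p y)) b) differentiable (at x)"
    by (intro differentiable_sum ballI term_diff finite_Basis)
  then obtain D where D: "((\<lambda>y. \<Sum>b\<in>Basis. (w y \<bullet> b) *\<^sub>R frechet_derivative f (at (p y)) b)
      has_derivative D) (at x)"
    unfolding differentiable_def by blast
  have expand: "(\<Sum>b\<in>Basis. (w y \<bullet> b) *\<^sub>R frechet_derivative f (at (p y)) b) =
      frechet_derivative f (at (p y)) (w y)" if "p y \<in> S" for y
  proof -
    have lin: "linear (frechet_derivative f (at (p y)))"
      using smooth_on_has_derivative[OF f(1,2) that] has_derivative_linear by blast
    have "frechet_derivative f (at (p y)) (w y) =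
        frechet_derivative f (at (p y)) (\<Sum>b\<in>Basis. (w y \<bullet> b) *\<^sub>R b)"
      by (simp add: euclidean_representation)
    then show ?thesis
      by (simp add: linear_sum[OF lin] linear_scale[OF lin])
  qed
  have "\<forall>\<^sub>F y in at x. p y \<in> S"
    using differentiable_imp_continuous_within[OF p] f(2,3)
    by (metis continuous_within topological_tendstoD)
  then have "\<forall>\<^sub>F y in at x. (\<Sum>b\<in>Basis. (w y \<bullet> b) *\<^sub>R frechet_derivative f (at (p y)) b) =
      frechet_derivative f (at (p y)) (w y)"
    by eventually_elim (rule expand)
  from has_derivative_transform_eventually[OF D this expand[OF f(3)]] show ?thesis
    unfolding differentiable_def by blast
qed

section \<open>The group in a chart around the identity\<close>

context lie_group
begin

abbreviation id_domain :: "'g set" where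
  "id_domain \<equiv> fst id_chart"

abbreviation origin :: 'a where
  "origin \<equiv> to_coord \<one>"

lemma id_chart_in_atlas: "(id_domain, to_coord) \<in> atlas" and one_in_id_domain: "\<one> \<in> id_domain"
proof -
  have "\<one> \<in> (\<Union>(U, \<phi>) \<in> atlas. U)"
    by (simp only: charts_cover one_closed)
  then have "\<exists>c. c \<in> atlas \<and> \<one> \<in> fst c"
    by (metis (no_types, lifting) UN_E case_prod_beta)
  then have "id_chart \<in> atlas \<and> \<one> \<in> fst id_chart"
    unfolding id_chart_def by (rule someI_ex)
  then show "(id_domain, to_coord) \<in> atlas" "\<one> \<in> id_domain"
    by (auto simp: to_coord_def)
qed

definition coord_domain :: "'a set" where
  "coord_domain = to_coord ` id_domain"

lemma openin_id_domain: "openin (top_of_set (carrier G)) id_domain"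
  using chart_domain id_chart_in_atlas by blast

lemma id_domain_subset: "id_domain \<subseteq> carrier G"
  using openin_id_domain openin_imp_subset by blast

lemma open_coord_domain: "open coord_domain"
  unfolding coord_domain_def using chart_range id_chart_in_atlas by blast

lemma homeomorphism_id_chart: "homeomorphism id_domain coord_domain to_coord of_coord"
  using chart_homeomorphism[OF id_chart_in_atlas] by (simp add: coord_domain_def of_coord_def)

lemma of_coord_to_coord: "g \<in> id_domain \<Longrightarrow> of_coord (to_coord g) = g"
  and to_coord_of_coord: "x \<in> coord_domain \<Longrightarrow> to_coord (of_coord x) = x"
  and to_coord_in: "g \<in> id_domain \<Longrightarrow> to_coord g \<in> coord_domain"
  and of_coord_in: "x \<in> coord_domain \<Longrightarrow> of_coord x \<in> id_domain"
  and continuous_of_coord: "continuous_on coord_domain of_coord"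
  using homeomorphism_id_chart by (auto simp: homeomorphism_def)

lemma of_coord_closed: "x \<in> coord_domain \<Longrightarrow> of_coord x \<in> carrier G"
  using of_coord_in id_domain_subset by blast

lemma origin_in: "origin \<in> coord_domain"
  by (simp add: to_coord_in one_in_id_domain)

lemma of_coord_origin: "of_coord origin = \<one>"
  by (simp add: of_coord_to_coord one_in_id_domain)

lemma continuous_on_group_mult:
  assumes "continuous_on S f" "continuous_on S h" "f ` S \<subseteq> carrier G" "h ` S \<subseteq> carrier G"
  shows "continuous_on S (\<lambda>x. f x \<otimes> h x)"
proof -
  have "continuous_on S (\<lambda>x. (\<lambda>(a, b). a \<otimes> b) (f x, h x))"
    by (rule continuous_on_compose2[OF mult_continuous]) (use assms in \<open>auto intro!: continuous_intros\<close>)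
  then show ?thesis by simp
qed

text \<open>The group operations read in the chart at \<open>\<one>\<close>, each with the open set on which both its arguments and
its value stay in the chart.\<close>

definition mult_domain :: "('a \<times> 'a) set" where
  "mult_domain = {(x, y). x \<in> coord_domain \<and> y \<in> coord_domain \<and> of_coord x \<otimes> of_coord y \<in> id_domain}"

definition coord_mult :: "'a \<times> 'a \<Rightarrow> 'a" where
  "coord_mult = (\<lambda>(x, y). to_coord (of_coord x \<otimes> of_coord y))"

definition inv_domain :: "'a set" where
  "inv_domain = {x \<in> coord_domain. m_inv G (of_coord x) \<in> id_domain}"

definition coord_inv :: "'a \<Rightarrow> 'a" where
  "coord_inv x = to_coord (m_inv G (of_coord x))"

lemma open_mult_domain: "open mult_domain"
proof -
  let ?m = "\<lambda>p. of_coord (fst p) \<otimes> of_coord (snd p)"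
  have "continuous_on (coord_domain \<times> coord_domain) ?m"
    by (rule continuous_on_group_mult)
       (auto intro!: continuous_on_compose2[OF continuous_of_coord] continuous_intros of_coord_closed)
  moreover have "?m \<in> coord_domain \<times> coord_domain \<rightarrow> carrier G"
    by (auto intro!: m_closed inv_closed of_coord_closed)
  ultimately have "openin (top_of_set (coord_domain \<times> coord_domain))
      (coord_domain \<times> coord_domain \<inter> ?m -` id_domain)"
    using openin_id_domain by (rule continuous_openin_preimage)
  moreover have "coord_domain \<times> coord_domain \<inter> ?m -` id_domain = mult_domain"
    by (auto simp: mult_domain_def)
  ultimately show ?thesis
    by (simp add: openin_open_eq open_Times open_coord_domain)
qed

lemma smooth_coord_mult: "smooth_on mult_domain coord_mult"
proof -
  have "mult_domain =
      {(to_coord g, to_coord h) | g h. g \<in> id_domain \<and> h \<in> id_domain \<and> g \<otimes> h \<in> id_domain}"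
    unfolding mult_domain_def
    by safe (metis of_coord_in to_coord_of_coord, auto simp: to_coord_in of_coord_to_coord)
  then show ?thesis
    using mult_smooth[OF id_chart_in_atlas id_chart_in_atlas id_chart_in_atlas]
    by (simp add: coord_mult_def of_coord_def)
qed

lemma open_inv_domain: "open inv_domain"
proof -
  have "continuous_on coord_domain (\<lambda>x. m_inv G (of_coord x))"
    by (rule continuous_on_compose2[OF inverse_continuous continuous_of_coord])
       (auto intro: of_coord_closed)
  moreover have "(\<lambda>x. m_inv G (of_coord x)) \<in> coord_domain \<rightarrow> carrier G"
    by (auto intro!: m_closed inv_closed of_coord_closed)
  ultimately have "openin (top_of_set coord_domain)
      (coord_domain \<inter> (\<lambda>x. m_inv G (of_coord x)) -` id_domain)"
    using openin_id_domain by (rule continuous_openin_preimage)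
  moreover have "coord_domain \<inter> (\<lambda>x. m_inv G (of_coord x)) -` id_domain = inv_domain"
    by (auto simp: inv_domain_def)
  ultimately show ?thesis
    by (simp add: openin_open_eq open_coord_domain)
qed

lemma smooth_coord_inv: "smooth_on inv_domain coord_inv"
proof -
  have "inv_domain = {to_coord g | g. g \<in> id_domain \<and> m_inv G g \<in> id_domain}"
    unfolding inv_domain_def
    by safe (metis of_coord_in to_coord_of_coord, auto simp: to_coord_in of_coord_to_coord)
  then show ?thesis
    using inverse_smooth[OF id_chart_in_atlas id_chart_in_atlas]
    by (simp add: coord_inv_def[abs_def] of_coord_def)
qed

lemma origin_in_inv_domain: "origin \<in> inv_domain"
  by (simp add: inv_domain_def origin_in of_coord_origin one_in_id_domain)

lemma inv_domain_subset: "inv_domain \<subseteq> coord_domain"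
  by (auto simp: inv_domain_def)

lemma of_coord_coord_inv: "x \<in> inv_domain \<Longrightarrow> of_coord (coord_inv x) = m_inv G (of_coord x)"
  by (simp add: inv_domain_def coord_inv_def of_coord_to_coord)

lemma coord_inv_in: "x \<in> inv_domain \<Longrightarrow> coord_inv x \<in> coord_domain"
  by (simp add: inv_domain_def coord_inv_def to_coord_in)

lemma mult_domain_inv:
  assumes "x \<in> inv_domain"
  shows "(x, coord_inv x) \<in> mult_domain" "(coord_inv x, x) \<in> mult_domain"
    "coord_mult (coord_inv x, x) = origin"
  using assms coord_inv_in[OF assms] of_coord_coord_inv[OF assms] of_coord_closed[of x] inv_domain_subset
  by (auto simp: mult_domain_def coord_mult_def one_in_id_domain)

lemma mult_domain_origin: "x \<in> coord_domain \<Longrightarrow> (x, origin) \<in> mult_domain"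
  and coord_mult_origin: "x \<in> coord_domain \<Longrightarrow> coord_mult (x, origin) = x"
  by (auto simp: mult_domain_def coord_mult_def origin_in of_coord_origin of_coord_closed of_coord_in
      to_coord_of_coord)

lemma of_coord_coord_mult:
  "(x, y) \<in> mult_domain \<Longrightarrow> of_coord (coord_mult (x, y)) = of_coord x \<otimes> of_coord y"
  by (simp add: mult_domain_def coord_mult_def of_coord_to_coord)

section \<open>A connected group is generated by a neighbourhood of the identity\<close>

lemma openin_left_translate:
  assumes g: "g \<in> carrier G" and N: "openin (top_of_set (carrier G)) N"
  shows "openin (top_of_set (carrier G)) {h \<in> carrier G. g \<otimes> h \<in> N}"
proof -
  have "continuous_on (carrier G) (\<lambda>h. g \<otimes> h)"
    by (rule continuous_on_group_mult) (use g in \<open>auto intro!: continuous_intros\<close>)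
  moreover have "(\<lambda>h. g \<otimes> h) \<in> carrier G \<rightarrow> carrier G"
    using g by auto
  ultimately have "openin (top_of_set (carrier G)) (carrier G \<inter> (\<lambda>h. g \<otimes> h) -` N)"
    using N by (rule continuous_openin_preimage)
  moreover have "carrier G \<inter> (\<lambda>h. g \<otimes> h) -` N = {h \<in> carrier G. g \<otimes> h \<in> N}"
    by auto
  ultimately show ?thesis by simp
qed

text \<open>A connected group is generated as a monoid by each neighbourhood \<open>N\<close> of \<open>\<one>\<close>: the set \<open>H\<close> of elements with
\<open>P\<close> contains \<open>h N\<close> with each \<open>h\<close>, so it is open; and the elements \<open>k\<close> with \<open>k\<inverse> h \<in> N\<close> form a
neighbourhood of \<open>h\<close> which cannot meet \<open>H\<close> unless \<open>h = k (k\<inverse> h) \<in> H\<close>, so \<open>H\<close> is closed as well.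
This is how statements about elements in the chart at \<open>\<one>\<close> are extended to the whole group.\<close>

lemma connected_group_induct:
  assumes conn: "connected (carrier G)"
    and N: "openin (top_of_set (carrier G)) N" "\<one> \<in> N"
    and one: "P \<one>"
    and step: "\<And>g n. g \<in> carrier G \<Longrightarrow> n \<in> N \<Longrightarrow> P g \<Longrightarrow> P (g \<otimes> n)"
    and g: "g \<in> carrier G"
  shows "P g"
proof -
  let ?H = "{g \<in> carrier G. P g}"
  have NG: "N \<subseteq> carrier G"
    using N(1) openin_imp_subset by blast
  have opN: "openin (top_of_set (carrier G)) {k \<in> carrier G. m_inv G h \<otimes> k \<in> N}"
    if "h \<in> carrier G" for h
    using that by (intro openin_left_translate N) auto
  have "openin (top_of_set (carrier G)) ?H"
  proof (subst openin_subopen, intro ballI)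
    fix h assume h: "h \<in> ?H"
    have "P k" if k: "k \<in> carrier G" "m_inv G h \<otimes> k \<in> N" for k
    proof -
      have "P (h \<otimes> (m_inv G h \<otimes> k))"
        using step h k by blast
      moreover have "h \<otimes> (m_inv G h \<otimes> k) = k"
        using h k by (simp add: m_assoc[symmetric])
      ultimately show ?thesis by simp
    qed
    then have "{k \<in> carrier G. m_inv G h \<otimes> k \<in> N} \<subseteq> ?H"
      by blast
    moreover have "h \<in> {k \<in> carrier G. m_inv G h \<otimes> k \<in> N}"
      using h N(2) by simp
    ultimately show "\<exists>T. openin (top_of_set (carrier G)) T \<and> h \<in> T \<and> T \<subseteq> ?H"
      using opN h by blast
  qed
  moreover have "openin (top_of_set (carrier G)) (carrier G - ?H)"
  proof (subst openin_subopen, intro ballI)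
    fix h assume h: "h \<in> carrier G - ?H"
    let ?T = "carrier G \<inter> (\<lambda>k. m_inv G k \<otimes> h) -` N"
    have "continuous_on (carrier G) (\<lambda>k. m_inv G k \<otimes> h)"
      by (rule continuous_on_group_mult) (use h in \<open>auto intro!: continuous_intros inverse_continuous\<close>)
    moreover have "(\<lambda>k. m_inv G k \<otimes> h) \<in> carrier G \<rightarrow> carrier G"
      using h by auto
    ultimately have "openin (top_of_set (carrier G)) ?T"
      using N(1) by (rule continuous_openin_preimage)
    moreover have "h \<in> ?T"
      using h N(2) by simp
    moreover have "\<not> P k" if k: "k \<in> ?T" for k
    proof
      assume "P k"
      then have "P (k \<otimes> (m_inv G k \<otimes> h))"
        using step k by blast
      moreover have "k \<otimes> (m_inv G k \<otimes> h) = h"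
        using h k by (simp add: m_assoc[symmetric])
      ultimately show False
        using h by simp
    qed
    then have "?T \<subseteq> carrier G - ?H"
      by blast
    ultimately show "\<exists>T. openin (top_of_set (carrier G)) T \<and> h \<in> T \<and> T \<subseteq> carrier G - ?H"
      by blast
  qed
  ultimately have "?H = {} \<or> ?H = carrier G"
    using conn unfolding connected_clopen closedin_def by auto
  then show ?thesis
    using one g by auto
qed

lemma openin_of_coord_image:
  assumes "open S" "S \<subseteq> coord_domain"
  shows "openin (top_of_set (carrier G)) (of_coord ` S)"
proof -
  have "openin (top_of_set coord_domain) S"
    using assms by (simp add: open_subset)
  then have "openin (top_of_set id_domain) (of_coord ` S)"
    by (rule homeomorphism_imp_open_map[OF homeomorphism_symD[OF homeomorphism_id_chart]])
  then show ?thesis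
    by (rule openin_trans[OF _ openin_id_domain])
qed

section \<open>The adjoint representation\<close>

definition conj_coord :: "'g \<Rightarrow> 'a \<Rightarrow> 'a" where
  "conj_coord g x = to_coord (g \<otimes> of_coord x \<otimes> m_inv G g)"

lemma Ad_eq_frechet_derivative: "Ad g = frechet_derivative (conj_coord g) (at origin)"
  by (simp add: fun_eq_iff Ad_def conj_coord_def[abs_def])

lemma conj_coord_origin: "g \<in> carrier G \<Longrightarrow> conj_coord g origin = origin"
  by (simp add: conj_coord_def of_coord_origin)

lemma eventually_conj_in_domain:
  assumes g: "g \<in> carrier G"
  shows "\<forall>\<^sub>F x in nhds origin. x \<in> coord_domain \<and> g \<otimes> of_coord x \<otimes> m_inv G g \<in> id_domain"
proof -
  let ?c = "\<lambda>x. g \<otimes> of_coord x \<otimes> m_inv G g"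
  have "continuous_on coord_domain ?c"
    by (intro continuous_on_group_mult continuous_on_const continuous_of_coord)
       (use g in \<open>auto intro!: of_coord_closed m_closed\<close>)
  moreover have "?c \<in> coord_domain \<rightarrow> carrier G"
    using g by (auto intro!: of_coord_closed m_closed)
  ultimately have "openin (top_of_set coord_domain) (coord_domain \<inter> ?c -` id_domain)"
    using openin_id_domain by (rule continuous_openin_preimage)
  then have "open (coord_domain \<inter> ?c -` id_domain)"
    by (simp add: openin_open_eq open_coord_domain)
  then have "\<forall>\<^sub>F x in nhds origin. x \<in> coord_domain \<inter> ?c -` id_domain"
    by (rule eventually_nhds_in_open) (use g in \<open>simp add: origin_in of_coord_origin one_in_id_domain\<close>)
  then show ?thesis
    by eventually_elim auto
qed

lemma eventually_conj_coord_mult: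
  assumes g: "g \<in> carrier G" and h: "h \<in> carrier G"
  shows "\<forall>\<^sub>F x in nhds origin. conj_coord g (conj_coord h x) = conj_coord (g \<otimes> h) x"
  using eventually_conj_in_domain[OF h]
proof eventually_elim
  case (elim x)
  then have "of_coord (conj_coord h x) = h \<otimes> of_coord x \<otimes> m_inv G h"
    by (simp add: conj_coord_def of_coord_to_coord)
  then show ?case
    using g h elim of_coord_closed[of x] by (simp add: conj_coord_def inv_mult_group m_assoc)
qed

text \<open>Conjugation by an element of the chart is \<open>y \<mapsto> m (m (x, y), x\<inverse>)\<close> with \<open>m\<close> the multiplication in
coordinates, so the chain rule expresses its differential by the first derivatives of \<open>m\<close>. As \<open>m\<close> is
\<open>C\<^sup>2\<close>, the formula can be differentiated once more in \<open>x\<close>, which gives the bracket.\<close>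

lemma has_derivative_conj_coord_of_coord:
  assumes x: "x \<in> inv_domain"
  shows "(conj_coord (of_coord x) has_derivative
      (\<lambda>v. frechet_derivative coord_mult (at (x, coord_inv x))
            (frechet_derivative coord_mult (at (x, origin)) (0, v), 0))) (at origin)"
proof -
  have xd: "x \<in> coord_domain"
    using x inv_domain_subset by blast
  have smooth: "(coord_mult has_derivative frechet_derivative coord_mult (at p)) (at p)"
    if "p \<in> mult_domain" for p
    using smooth_on_has_derivative[OF smooth_coord_mult open_mult_domain that] .
  have pair: "((\<lambda>y. (x, y)) has_derivative (\<lambda>v. (0, v))) (at origin)"
    by (auto intro!: derivative_eq_intros)
  have right: "((\<lambda>y. coord_mult (x, y)) has_derivative
      (\<lambda>v. frechet_derivative coord_mult (at (x, origin)) (0, v))) (at origin)"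
    by (rule has_derivative_compose[OF pair smooth[OF mult_domain_origin[OF xd]]])
  have "((\<lambda>y. (coord_mult (x, y), coord_inv x)) has_derivative
      (\<lambda>v. (frechet_derivative coord_mult (at (x, origin)) (0, v), 0))) (at origin)"
    by (intro has_derivative_Pair right has_derivative_const)
  moreover have "(coord_mult has_derivative frechet_derivative coord_mult (at (x, coord_inv x)))
      (at (coord_mult (x, origin), coord_inv x))"
    by (simp add: coord_mult_origin[OF xd] smooth mult_domain_inv(1)[OF x])
  ultimately have D: "((\<lambda>y. coord_mult (coord_mult (x, y), coord_inv x)) has_derivative
      (\<lambda>v. frechet_derivative coord_mult (at (x, coord_inv x))
            (frechet_derivative coord_mult (at (x, origin)) (0, v), 0))) (at origin)"
    by (rule has_derivative_compose)
  have eq: "coord_mult (coord_mult (x, y), coord_inv x) = conj_coord (of_coord x) y"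
    if "(x, y) \<in> mult_domain" for y
  proof -
    have "of_coord (coord_mult (x, y)) = of_coord x \<otimes> of_coord y"
      by (rule of_coord_coord_mult[OF that])
    then show ?thesis
      using of_coord_coord_inv[OF x]
      by (simp add: conj_coord_def coord_mult_def)
  qed
  have "continuous (at origin) (\<lambda>y. (x, y))"
    by (intro continuous_intros)
  then have "\<forall>\<^sub>F y in at origin. (x, y) \<in> mult_domain"
    using open_mult_domain mult_domain_origin[OF xd]
    by (metis continuous_within topological_tendstoD)
  then have "\<forall>\<^sub>F y in at origin. coord_mult (coord_mult (x, y), coord_inv x) = conj_coord (of_coord x) y"
    by eventually_elim (rule eq)
  from has_derivative_transform_eventually[OF D this eq[OF mult_domain_origin[OF xd]]]
  show ?thesis by simp
qed

lemma Ad_of_coord: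
  assumes "x \<in> inv_domain"
  shows "Ad (of_coord x) v = frechet_derivative coord_mult (at (x, coord_inv x))
            (frechet_derivative coord_mult (at (x, origin)) (0, v), 0)"
  using frechet_derivative_at[OF has_derivative_conj_coord_of_coord[OF assms]]
  by (simp add: Ad_eq_frechet_derivative fun_eq_iff)

lemma Ad_of_coord_differentiable:
  assumes x: "x \<in> inv_domain"
  shows "(\<lambda>y. Ad (of_coord y) v) differentiable (at x)"
proof -
  have xd: "x \<in> coord_domain"
    using x inv_domain_subset by blast
  have pair: "(\<lambda>y. (y, origin)) differentiable (at x)"
    by (auto simp: differentiable_def intro!: derivative_eq_intros)
  have "(\<lambda>y. frechet_derivative coord_mult (at (y, origin)) (0, v)) differentiable (at x)"
    by (rule smooth_on_frechet_derivative_apply_differentiable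
        [OF smooth_coord_mult open_mult_domain _ pair differentiable_const])
       (rule mult_domain_origin[OF xd])
  then obtain D1 where D1: "((\<lambda>y. frechet_derivative coord_mult (at (y, origin)) (0, v))
      has_derivative D1) (at x)"
    unfolding differentiable_def by blast
  have w: "(\<lambda>y. (frechet_derivative coord_mult (at (y, origin)) (0, v), 0::'a)) differentiable (at x)"
    unfolding differentiable_def using has_derivative_Pair[OF D1 has_derivative_const] by blast
  have p: "(\<lambda>y. (y, coord_inv y)) differentiable (at x)"
    unfolding differentiable_def
    using has_derivative_Pair[OF has_derivative_ident
        smooth_on_has_derivative[OF smooth_coord_inv open_inv_domain x]] by blast
  have "(\<lambda>y. frechet_derivative coord_mult (at (y, coord_inv y))
      (frechet_derivative coord_mult (at (y, origin)) (0, v), 0)) differentiable (at x)"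
    by (rule smooth_on_frechet_derivative_apply_differentiable
        [OF smooth_coord_mult open_mult_domain _ p w])
       (rule mult_domain_inv(1)[OF x])
  then obtain D where D: "((\<lambda>y. frechet_derivative coord_mult (at (y, coord_inv y))
      (frechet_derivative coord_mult (at (y, origin)) (0, v), 0)) has_derivative D) (at x)"
    unfolding differentiable_def by blast
  have "((\<lambda>y. Ad (of_coord y) v) has_derivative D) (at x)"
    by (rule has_derivative_transform_within_open[OF D open_inv_domain x]) (simp add: Ad_of_coord)
  then show ?thesis
    unfolding differentiable_def by blast
qed

text \<open>The bracket is defined by \<^const>\<open>frechet_derivative\<close>, whose value has no meaning at a point of
non-differentiability; differentiability of \<open>Ad\<close> is what turns the definition into a statement about
limits.\<close>

lemma has_derivative_lie_bracket:
  "((\<lambda>x. Ad (of_coord x) v) has_derivative (\<lambda>u. lie_bracket u v)) (at origin)"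
  using Ad_of_coord_differentiable[OF origin_in_inv_domain, of v]
  by (simp add: lie_bracket_def[abs_def] frechet_derivative_works)

end

locale connected_lie_group = lie_group G atlas
  for G :: "'g::{t2_space, second_countable_topology} monoid" (structure)
    and atlas :: "('g set \<times> ('g \<Rightarrow> 'a::euclidean_space)) set" +
  assumes connected_carrier: "connected (carrier G)"
begin

text \<open>For \<open>g\<close> far from \<open>\<one>\<close> the conjugation leaves the chart on the way, but it is a composition of
conjugations by elements of the chart, each of which fixes the origin.\<close>

lemma has_derivative_conj_coord:
  assumes "g \<in> carrier G"
  shows "(conj_coord g has_derivative Ad g) (at origin)"
proof -
  have local_diff: "conj_coord n differentiable (at origin)" if "n \<in> of_coord ` inv_domain" for n
    using that has_derivative_conj_coord_of_coord by (auto simp: differentiable_def)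
  have one: "\<one> \<in> of_coord ` inv_domain"
    using origin_in_inv_domain of_coord_origin by force
  have "conj_coord g differentiable (at origin)"
  proof (rule connected_group_induct[OF connected_carrier _ one _ _ assms])
    show "openin (top_of_set (carrier G)) (of_coord ` inv_domain)"
      by (rule openin_of_coord_image[OF open_inv_domain inv_domain_subset])
    show "conj_coord \<one> differentiable (at origin)"
      by (rule local_diff[OF one])
    fix g n assume g: "g \<in> carrier G" and n: "n \<in> of_coord ` inv_domain"
      and diff: "conj_coord g differentiable (at origin)"
    have nG: "n \<in> carrier G"
      using n inv_domain_subset of_coord_closed by blast
    obtain D where D: "(conj_coord g has_derivative D) (at (conj_coord n origin))"
      using diff unfolding differentiable_def by (auto simp: conj_coord_origin[OF nG])
    obtain E where E: "(conj_coord n has_derivative E) (at origin)"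
      using local_diff[OF n] unfolding differentiable_def by blast
    have "((\<lambda>x. conj_coord g (conj_coord n x)) has_derivative (\<lambda>v. D (E v))) (at origin)"
      by (rule has_derivative_compose[OF E D])
    then have "(conj_coord (g \<otimes> n) has_derivative (\<lambda>v. D (E v))) (at origin)"
      by (rule has_derivative_transform_eventually)
         (use eventually_conj_coord_mult[OF g nG] in
           \<open>auto simp: eventually_nhds_conv_at\<close>)
    then show "conj_coord (g \<otimes> n) differentiable (at origin)"
      unfolding differentiable_def by blast
  qed
  then show ?thesis
    unfolding Ad_eq_frechet_derivative by (simp add: frechet_derivative_works)
qed

lemma linear_Ad: "g \<in> carrier G \<Longrightarrow> linear (Ad g)"
  using has_derivative_conj_coord has_derivative_linear by blast

lemma Ad_mult:
  assumes g: "g \<in> carrier G" and h: "h \<in> carrier G"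
  shows "Ad (g \<otimes> h) v = Ad g (Ad h v)"
proof -
  have "((\<lambda>x. conj_coord g (conj_coord h x)) has_derivative (\<lambda>v. Ad g (Ad h v))) (at origin)"
    by (rule has_derivative_compose[OF has_derivative_conj_coord[OF h]])
       (simp add: conj_coord_origin[OF h] has_derivative_conj_coord[OF g])
  then have "(conj_coord (g \<otimes> h) has_derivative (\<lambda>v. Ad g (Ad h v))) (at origin)"
    by (rule has_derivative_transform_eventually)
       (use eventually_conj_coord_mult[OF g h] in \<open>auto simp: eventually_nhds_conv_at\<close>)
  then have "Ad (g \<otimes> h) = (\<lambda>v. Ad g (Ad h v))"
    using has_derivative_conj_coord[of "g \<otimes> h"] g h has_derivative_unique by blast
  then show ?thesis by simp
qed

lemma Ad_one: "Ad \<one> v = v"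
proof -
  have "((\<lambda>x. x) has_derivative (\<lambda>v. v)) (at origin)"
    by (rule has_derivative_ident)
  then have "(conj_coord \<one> has_derivative (\<lambda>v. v)) (at origin)"
    by (rule has_derivative_transform_within_open[OF _ open_coord_domain origin_in])
       (simp add: conj_coord_def of_coord_closed to_coord_of_coord)
  then show ?thesis
    using has_derivative_conj_coord[OF one_closed] has_derivative_unique by metis
qed

text \<open>Infinitesimal invariance implies invariance. Left translation carries the hypothesis from the origin
to every point of a coordinate ball, so \<open>\<phi>\<close> is constant on each translate of the ball, and these
translates reach the whole group. It takes the place of integration
along one-parameter subgroups.\<close>

lemma zero_left_derivative_imp_constant:
  fixes \<phi> :: "'g \<Rightarrow> real"
  assumes zero: "\<And>g. g \<in> carrier G \<Longrightarrow>
      ((\<lambda>x. \<phi> (g \<otimes> of_coord x)) has_derivative (\<lambda>_. 0)) (at origin)"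
    and g: "g \<in> carrier G"
  shows "\<phi> g = \<phi> \<one>"
proof -
  obtain r where r: "r > 0" "ball origin r \<subseteq> inv_domain"
    using open_inv_domain origin_in_inv_domain open_contains_ball by blast
  have deriv: "((\<lambda>x. \<phi> (h \<otimes> of_coord x)) has_derivative (\<lambda>_. 0)) (at x)"
    if h: "h \<in> carrier G" and x: "x \<in> inv_domain" for h x
  proof -
    have xG: "of_coord x \<in> carrier G"
      using x inv_domain_subset of_coord_closed by blast
    have pair: "((\<lambda>y. (coord_inv x, y)) has_derivative (\<lambda>v. (0, v))) (at x)"
      by (auto intro!: derivative_eq_intros)
    have D: "((\<lambda>y. coord_mult (coord_inv x, y)) has_derivative
        (\<lambda>v. frechet_derivative coord_mult (at (coord_inv x, x)) (0, v))) (at x)"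
      by (rule has_derivative_compose[OF pair smooth_on_has_derivative
            [OF smooth_coord_mult open_mult_domain mult_domain_inv(2)[OF x]]])
    \<comment> \<open>Near \<open>x\<close> the point \<open>y\<close> is \<open>x\<close> times a small element \<open>x\<inverse> y\<close>, so the hypothesis applies at
      the base point \<open>h x\<close> in place of \<open>h\<close>.\<close>
    have "((\<lambda>z. \<phi> (h \<otimes> of_coord x \<otimes> of_coord z)) has_derivative (\<lambda>_. 0))
        (at (coord_mult (coord_inv x, x)))"
      using zero[of "h \<otimes> of_coord x"] h xG by (simp add: mult_domain_inv(3)[OF x])
    from has_derivative_compose[OF D this]
    have comp: "((\<lambda>y. \<phi> (h \<otimes> of_coord x \<otimes> of_coord (coord_mult (coord_inv x, y))))
        has_derivative (\<lambda>_. 0)) (at x)" .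
    have eq: "\<phi> (h \<otimes> of_coord x \<otimes> of_coord (coord_mult (coord_inv x, y))) = \<phi> (h \<otimes> of_coord y)"
      if y: "(coord_inv x, y) \<in> mult_domain" for y
    proof -
      have yG: "of_coord y \<in> carrier G"
        using y by (auto simp: mult_domain_def of_coord_closed)
      have "of_coord x \<otimes> (m_inv G (of_coord x) \<otimes> of_coord y) = of_coord y"
        using xG yG by (simp add: m_assoc[symmetric])
      then have "h \<otimes> of_coord x \<otimes> (m_inv G (of_coord x) \<otimes> of_coord y) = h \<otimes> of_coord y"
        using h xG yG by (simp add: m_assoc)
      then show ?thesis
        by (simp add: of_coord_coord_mult[OF y] of_coord_coord_inv[OF x])
    qed
    have "continuous (at x) (\<lambda>y. (coord_inv x, y))"
      by (intro continuous_intros)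
    then have "\<forall>\<^sub>F y in at x. (coord_inv x, y) \<in> mult_domain"
      using open_mult_domain mult_domain_inv(2)[OF x]
      by (metis continuous_within topological_tendstoD)
    then have "\<forall>\<^sub>F y in at x. \<phi> (h \<otimes> of_coord x \<otimes> of_coord (coord_mult (coord_inv x, y))) =
        \<phi> (h \<otimes> of_coord y)"
      by eventually_elim (rule eq)
    from has_derivative_transform_eventually[OF comp this eq[OF mult_domain_inv(2)[OF x]]]
    show ?thesis by simp
  qed
  have ball_const: "\<phi> (h \<otimes> n) = \<phi> h" if h: "h \<in> carrier G" and n: "n \<in> of_coord ` ball origin r" for h n
  proof -
    obtain x where x: "x \<in> ball origin r" "n = of_coord x"
      using n by blast
    have "\<phi> (h \<otimes> of_coord x) = \<phi> (h \<otimes> of_coord origin)"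
    proof (rule has_derivative_zero_unique[of "ball origin r" "\<lambda>x. \<phi> (h \<otimes> of_coord x)" x origin])
      show "((\<lambda>x. \<phi> (h \<otimes> of_coord x)) has_derivative (\<lambda>_. 0)) (at y within ball origin r)"
        if "y \<in> ball origin r" for y
        using deriv[OF h] r(2) that has_derivative_at_withinI by blast
    qed (use x r(1) in auto)
    then show ?thesis
      using h x by (simp add: of_coord_origin)
  qed
  show ?thesis
  proof (rule connected_group_induct[OF connected_carrier, where P = "\<lambda>g. \<phi> g = \<phi> \<one>"])
    show "openin (top_of_set (carrier G)) (of_coord ` ball origin r)"
      using r(2) inv_domain_subset by (intro openin_of_coord_image) auto
    show "\<one> \<in> of_coord ` ball origin r"
      using r(1) of_coord_origin by (metis centre_in_ball image_eqI)
  qed (use ball_const g in auto)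
qed

end

section \<open>Coadjoint orbits\<close>

locale presented_lie_group = connected_lie_group G atlas
  for G :: "'g::{t2_space, second_countable_topology} monoid" (structure)
    and atlas :: "('g set \<times> ('g \<Rightarrow> 'a::euclidean_space)) set" +
  fixes \<iota> :: "real^'n::finite \<Rightarrow> 'a"
    and br :: "real^'n \<Rightarrow> real^'n \<Rightarrow> real^'n"
  assumes has_algebra: "has_lie_algebra \<iota> br"
begin

abbreviation coords :: "'a \<Rightarrow> real^'n" where
  "coords \<equiv> inv_into UNIV \<iota>"

lemma linear_iota: "linear \<iota>" and bij_iota: "bij \<iota>"
  and iota_bracket: "\<iota> (br u v) = lie_bracket (\<iota> u) (\<iota> v)"
  using has_algebra by (auto simp: has_lie_algebra_def)

lemma coords_iota: "coords (\<iota> u) = u" and iota_coords: "\<iota> (coords v) = v"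
  using bij_iota by (simp_all add: bij_is_inj bij_is_surj surj_f_inv_f)

lemma linear_coords: "linear coords"
proof (rule linearI)
  show "coords (u + v) = coords u + coords v" for u v
    using linear_add[OF linear_iota, of "coords u" "coords v"] by (metis coords_iota iota_coords)
  show "coords (r *\<^sub>R u) = r *\<^sub>R coords u" for r u
    using linear_scale[OF linear_iota, of r "coords u"] by (metis coords_iota iota_coords)
qed

definition adj :: "'g \<Rightarrow> real^'n \<Rightarrow> real^'n" where
  "adj g z = coords (Ad g (\<iota> z))"

lemma linear_adj: "g \<in> carrier G \<Longrightarrow> linear (adj g)"
  using linear_compose[OF linear_compose[OF linear_iota linear_Ad] linear_coords]
  by (simp add: adj_def[abs_def] o_def)

lemma adj_mult: "g \<in> carrier G \<Longrightarrow> h \<in> carrier G \<Longrightarrow> adj (g \<otimes> h) z = adj g (adj h z)"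
  by (simp add: adj_def Ad_mult iota_coords)

lemma adj_one: "adj \<one> z = z"
  by (simp add: adj_def Ad_one coords_iota)

lemma adj_eq_0_iff:
  assumes "g \<in> carrier G"
  shows "adj g z = 0 \<longleftrightarrow> z = 0"
proof
  assume "adj g z = 0"
  then have "adj (m_inv G g \<otimes> g) z = adj (m_inv G g) 0"
    using assms by (simp only: adj_mult inv_closed)
  then show "z = 0"
    using assms linear_0[OF linear_adj[of "m_inv G g"]] by (simp add: adj_one)
qed (simp add: linear_0[OF linear_adj[OF assms]])

lemma has_derivative_adj:
  "((\<lambda>x. adj (of_coord x) z) has_derivative (\<lambda>u. br (coords u) z)) (at origin)"
proof -
  have "((\<lambda>x. coords (Ad (of_coord x) (\<iota> z))) has_derivative (\<lambda>u. coords (lie_bracket u (\<iota> z)))) (at origin)"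
    by (rule has_derivative_compose[OF has_derivative_lie_bracket
          linear_imp_has_derivative[OF linear_coords]])
  moreover have "coords (lie_bracket u (\<iota> z)) = br (coords u) z" for u
    using iota_bracket[of "coords u" z] by (metis coords_iota iota_coords)
  ultimately show ?thesis
    by (simp add: adj_def[abs_def])
qed

lemma continuous_on_adj: "continuous_on inv_domain (\<lambda>x. adj (of_coord x) z)"
proof -
  have "continuous_on inv_domain (\<lambda>x. Ad (of_coord x) (\<iota> z))"
    by (intro continuous_at_imp_continuous_on ballI differentiable_imp_continuous_within
        Ad_of_coord_differentiable)
  then show ?thesis
    unfolding adj_def
    by (rule linear_continuous_on_compose[OF _ linear_coords])
qed

text \<open>The right action \<open>F \<mapsto> F \<circ> Ad g\<close>. It has the same orbits as the coadjoint representation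
\<open>F \<mapsto> F \<circ> Ad (g\<inverse>)\<close>, and its derivative at \<open>\<one>\<close>, the vector field \<open>coad_field u\<close> given by
\<open>F \<mapsto> \<langle>F, [u, \<cdot>]\<rangle>\<close>, is available without differentiating the inverse.\<close>

definition coadj :: "'g \<Rightarrow> real^'n \<Rightarrow> real^'n" where
  "coadj g F = (\<chi> i. F \<bullet> adj g (axis i 1))"

definition coad_field :: "real^'n \<Rightarrow> real^'n \<Rightarrow> real^'n" where
  "coad_field u F = (\<chi> i. F \<bullet> br u (axis i 1))"

lemma coadj_inner:
  assumes "g \<in> carrier G"
  shows "coadj g F \<bullet> z = F \<bullet> adj g z"
proof -
  have "adj g z = adj g (\<Sum>i\<in>UNIV. z $ i *\<^sub>R axis i 1)"
    by (subst basis_expansion[of z, unfolded scalar_mult_eq_scaleR, symmetric]) simp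
  also have "\<dots> = (\<Sum>i\<in>UNIV. z $ i *\<^sub>R adj g (axis i 1))"
    by (simp add: linear_sum[OF linear_adj[OF assms]] linear_scale[OF linear_adj[OF assms]])
  finally have "F \<bullet> adj g z = (\<Sum>i\<in>UNIV. (F \<bullet> adj g (axis i 1)) * z $ i)"
    by (simp add: inner_sum_right mult.commute)
  then show ?thesis
    unfolding coadj_def by (subst inner_vec_def) simp
qed

lemma coadj_mult:
  "g \<in> carrier G \<Longrightarrow> h \<in> carrier G \<Longrightarrow> coadj (g \<otimes> h) F = coadj h (coadj g F)"
  by (simp add: vec_eq_iff coadj_def[of "g \<otimes> h"] coadj_def[of h] adj_mult coadj_inner)

lemma coadj_one: "coadj \<one> F = F"
  by (simp add: vec_eq_iff coadj_def adj_one inner_axis)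

lemma coadjoint_orbit_eq: "coadjoint_orbit \<iota> F = {coadj g F | g. g \<in> carrier G}"
proof -
  have "coadjoint \<iota> g F = coadj (m_inv G g) F" for g
    by (simp add: coadjoint_def coadj_def adj_def)
  then show ?thesis
    unfolding coadjoint_orbit_def by (metis (no_types, opaque_lifting) inv_closed inv_inv)
qed

lemma has_derivative_coadj:
  "((\<lambda>x. coadj (of_coord x) F) has_derivative (\<lambda>u. coad_field (coords u) F)) (at origin)"
proof -
  have "((\<lambda>x. \<Sum>i\<in>UNIV. (F \<bullet> adj (of_coord x) (axis i 1)) *\<^sub>R (axis i 1 :: real^'n)) has_derivative
      (\<lambda>u. \<Sum>i\<in>UNIV. (F \<bullet> br (coords u) (axis i 1)) *\<^sub>R axis i 1)) (at origin)"
    by (intro has_derivative_sum has_derivative_scaleR_left has_derivative_inner_right has_derivative_adj)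
  moreover have "(\<Sum>i\<in>UNIV. w i *\<^sub>R axis i 1) = (\<chi> i. w i)" for w :: "'n \<Rightarrow> real"
    using basis_expansion[of "\<chi> i. w i"] by (simp add: scalar_mult_eq_scaleR)
  ultimately show ?thesis
    by (simp add: coadj_def coad_field_def)
qed

text \<open>Linearity of the bracket in \<open>z\<close> is inherited from \<open>Ad\<close>: both sides are the derivative of
\<open>x \<mapsto> \<langle>F, Ad x z\<rangle>\<close>, computed coordinate by coordinate and directly.\<close>

lemma coad_field_inner: "coad_field u F \<bullet> z = F \<bullet> br u z"
proof -
  have "((\<lambda>x. coadj (of_coord x) F \<bullet> z) has_derivative (\<lambda>v. coad_field (coords v) F \<bullet> z)) (at origin)"
    by (rule has_derivative_inner_left[OF has_derivative_coadj])
  moreover have "((\<lambda>x. coadj (of_coord x) F \<bullet> z) has_derivative (\<lambda>v. F \<bullet> br (coords v) z)) (at origin)"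
    by (rule has_derivative_transform_within_open[OF
          has_derivative_inner_right[OF has_derivative_adj] open_coord_domain origin_in])
       (simp add: coadj_inner of_coord_closed)
  ultimately have "(\<lambda>v. coad_field (coords v) F \<bullet> z) = (\<lambda>v. F \<bullet> br (coords v) z)"
    by (rule has_derivative_unique)
  from fun_cong[OF this, of "\<iota> u"] show ?thesis
    by (simp add: coords_iota)
qed

text \<open>Because \<open>coadj\<close> is an action, its behaviour near \<open>h\<close> is its behaviour near \<open>\<one>\<close> at the form
\<open>coadj h F\<close>. So a function that is annihilated by the fields \<open>coad_field u\<close> along the orbit of \<open>F\<close> has zero
left derivative on the group.\<close>

lemma coadj_invariant:
  fixes f :: "real^'n \<Rightarrow> real"
  assumes deriv: "\<And>h. h \<in> carrier G \<Longrightarrow> (f has_derivative D h) (at (coadj h F))"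
    and tangent: "\<And>h u. h \<in> carrier G \<Longrightarrow> D h (coad_field u (coadj h F)) = 0"
    and g: "g \<in> carrier G"
  shows "f (coadj g F) = f F"
proof -
  have "f (coadj g F) = f (coadj \<one> F)"
  proof (rule zero_left_derivative_imp_constant[OF _ g])
    fix h assume h: "h \<in> carrier G"
    have "(f has_derivative D h) (at (coadj (of_coord origin) (coadj h F)))"
      by (simp add: of_coord_origin coadj_one deriv[OF h])
    from has_derivative_compose[OF has_derivative_coadj this]
    have "((\<lambda>x. f (coadj (of_coord x) (coadj h F))) has_derivative (\<lambda>_. 0)) (at origin)"
      by (simp add: tangent[OF h])
    then show "((\<lambda>x. f (coadj (h \<otimes> of_coord x) F)) has_derivative (\<lambda>_. 0)) (at origin)"
      by (rule has_derivative_transform_within_open[OF _ open_coord_domain origin_in])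
         (simp add: coadj_mult h of_coord_closed)
  qed
  then show ?thesis by (simp add: coadj_one)
qed

text \<open>Infinitesimally \<open>w = Ad g z\<close> changes by a multiple of itself, so its direction does not move. The
quotient \<open>(w \<bullet> y)\<^sup>2 / (w \<bullet> w)\<close> sees only the direction, and has zero derivative; it vanishes at \<open>\<one>\<close> if
\<open>y\<close> is orthogonal to \<open>z\<close>. Choosing for \<open>y\<close> the component of \<open>Ad g z\<close> orthogonal to \<open>z\<close> shows that this
component is zero. In this way no differential equation for the eigenvalue has to be solved.\<close>

lemma adj_eigenvector:
  assumes eigen: "\<And>u. br u z = a u *\<^sub>R z" and z: "z \<noteq> 0" and g: "g \<in> carrier G"
  shows "\<exists>c. c \<noteq> 0 \<and> adj g z = c *\<^sub>R z"
proof -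
  define y where "y = adj g z - ((adj g z \<bullet> z) / (z \<bullet> z)) *\<^sub>R z"
  have yz: "z \<bullet> y = 0"
    using z by (simp add: y_def inner_diff_right inner_commute)
  let ?\<phi> = "\<lambda>h. (adj h z \<bullet> y)\<^sup>2 / (adj h z \<bullet> adj h z)"
  have "?\<phi> g = ?\<phi> \<one>"
  proof (rule zero_left_derivative_imp_constant[OF _ g])
    fix h assume h: "h \<in> carrier G"
    define w where "w = adj h z"
    have w0: "w \<bullet> w \<noteq> 0"
      using h z by (simp add: w_def adj_eq_0_iff)
    have at0: "adj h (adj (of_coord origin) z) = w"
      by (simp add: of_coord_origin adj_one w_def)
    have "((\<lambda>x. adj h (adj (of_coord x) z)) has_derivative (\<lambda>u. adj h (br (coords u) z))) (at origin)"
      by (rule has_derivative_compose[OF has_derivative_adj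
            linear_imp_has_derivative[OF linear_adj[OF h]]])
    then have D: "((\<lambda>x. adj h (adj (of_coord x) z)) has_derivative (\<lambda>u. a (coords u) *\<^sub>R w)) (at origin)"
      by (simp add: eigen linear_scale[OF linear_adj[OF h]] w_def)
    have "((\<lambda>x. (adj h (adj (of_coord x) z) \<bullet> y)\<^sup>2 /
        (adj h (adj (of_coord x) z) \<bullet> adj h (adj (of_coord x) z))) has_derivative (\<lambda>_. 0)) (at origin)"
      using w0
      by - ((rule derivative_eq_intros D | simp add: at0)+,
            simp add: fun_eq_iff power2_eq_square field_simps)
    then show "((\<lambda>x. ?\<phi> (h \<otimes> of_coord x)) has_derivative (\<lambda>_. 0)) (at origin)"
      by (rule has_derivative_transform_within_open[OF _ open_coord_domain origin_in])
         (simp add: adj_mult h of_coord_closed)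
  qed
  then have "adj g z \<bullet> y = 0"
    using g z yz by (simp add: adj_one adj_eq_0_iff)
  then have "y \<bullet> y = 0"
    using yz by (simp add: y_def inner_diff_left inner_commute)
  then have "adj g z = ((adj g z \<bullet> z) / (z \<bullet> z)) *\<^sub>R z"
    by (simp add: y_def)
  moreover have "adj g z \<noteq> 0"
    using g z by (simp add: adj_eq_0_iff)
  ultimately show ?thesis
    by (metis scale_zero_left)
qed

lemma coadj_eigenform:
  assumes "\<And>u. br u z = a u *\<^sub>R z" "z \<noteq> 0" "g \<in> carrier G"
  shows "\<exists>c. c \<noteq> 0 \<and> (\<forall>F. coadj g F \<bullet> z = c * (F \<bullet> z))"
  using adj_eigenvector[OF assms] assms(3) by (auto simp: coadj_inner)

text \<open>The hypothesis says that no \<open>z \<noteq> 0\<close> is orthogonal both to all tangent vectors \<open>\<langle>F, [u, \<cdot>]\<rangle>\<close> of the orbit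
and to \<open>n\<close>, that is, the orbit and the direction \<open>n\<close> span the whole space at \<open>F\<close>. Then
\<open>(x, t) \<mapsto> coadj x F + t n\<close> has a surjective derivative at the origin, and the open mapping theorem of
Sussmann, for continuous maps with a surjective derivative at a single point, applies.\<close>

lemma orbit_thickened_is_neighbourhood:
  assumes nondeg: "\<And>z. (\<And>u. F \<bullet> br u z = 0) \<Longrightarrow> n \<bullet> z = 0 \<Longrightarrow> z = 0"
  shows "F \<in> interior {coadj g F + t *\<^sub>R n | g t. g \<in> carrier G}"
proof -
  define f where "f = (\<lambda>p::'a \<times> real. coadj (of_coord (fst p)) F + snd p *\<^sub>R n)"
  define D where "D = (\<lambda>p::'a \<times> real. coad_field (coords (fst p)) F + snd p *\<^sub>R n)"
  let ?S = "inv_domain \<times> (UNIV :: real set)"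
  have cont: "continuous_on ?S f"
    unfolding f_def coadj_def
    by (intro continuous_intros continuous_on_compose2[OF continuous_on_adj]) auto
  have f0: "f (origin, 0) = F"
    by (simp add: f_def of_coord_origin coadj_one)
  have deriv: "(f has_derivative D) (at (origin, 0))"
  proof -
    have fst: "((\<lambda>p::'a \<times> real. fst p) has_derivative (\<lambda>p. fst p)) (at (origin, 0))"
      by (auto intro!: derivative_eq_intros)
    have "((\<lambda>p::'a \<times> real. coadj (of_coord (fst p)) F) has_derivative
        (\<lambda>p. coad_field (coords (fst p)) F)) (at (origin, 0))"
      by (rule has_derivative_compose[OF fst]) (simp add: has_derivative_coadj)
    then show ?thesis
      unfolding f_def D_def by (auto intro!: derivative_eq_intros)
  qed
  have lin: "linear D"
    using deriv has_derivative_linear by blast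
  \<comment> \<open>A vector orthogonal to the range of \<open>D\<close> lies in the radical at \<open>F\<close> and is orthogonal to \<open>n\<close>.\<close>
  have "surj D"
  proof (rule ccontr)
    assume "\<not> surj D"
    moreover have "span (range D) = range D"
      by (simp add: linear_subspace_image[OF lin])
    ultimately have "dim (range D) < DIM(real^'n)"
      by (metis dim_eq_full dim_subset_UNIV order_le_imp_less_or_eq)
    then obtain z where z: "z \<noteq> 0" and orth: "\<And>w. w \<in> span (range D) \<Longrightarrow> orthogonal z w"
      using orthogonal_to_subspace_exists by metis
    have Dz: "D p \<bullet> z = 0" for p
      using orth[OF span_base[of "D p"]] by (simp add: orthogonal_def inner_commute)
    have "F \<bullet> br u z = 0" for u
      using Dz[of "(\<iota> u, 0)"] by (simp add: D_def coords_iota coad_field_inner)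
    moreover have "coad_field 0 F \<bullet> z + n \<bullet> z = 0"
      using Dz[of "(0, 1)"] by (simp add: D_def linear_0[OF linear_coords] inner_add_left)
    ultimately have "z = 0"
      by (intro nondeg) (simp_all add: coad_field_inner)
    with z show False by simp
  qed
  then obtain D' where D': "linear D'" "D \<circ> D' = id"
    using linear_surjective_right_inverse[OF lin] by blast
  have "f (origin, 0) \<in> interior (f ` ?S)"
  proof (rule sussmann_open_mapping[OF _ cont _ deriv _ D'(2) subset_refl])
    show "open ?S"
      by (simp add: open_Times open_inv_domain)
    then show "(origin, 0) \<in> interior ?S"
      by (simp add: interior_open origin_in_inv_domain)
    show "(origin, 0) \<in> ?S"
      by (simp add: origin_in_inv_domain)
    show "bounded_linear D'"
      using D'(1) by (simp add: linear_conv_bounded_linear)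
  qed
  moreover have "f ` ?S \<subseteq> {coadj g F + t *\<^sub>R n | g t. g \<in> carrier G}"
  proof
    fix K assume "K \<in> f ` ?S"
    then obtain p where p: "p \<in> ?S" "K = f p"
      by blast
    then have "fst p \<in> inv_domain" "K = coadj (of_coord (fst p)) F + snd p *\<^sub>R n"
      by (auto simp: f_def)
    then show "K \<in> {coadj g F + t *\<^sub>R n | g t. g \<in> carrier G}"
      using inv_domain_subset of_coord_closed by blast
  qed
  ultimately have "f (origin, 0) \<in> interior {coadj g F + t *\<^sub>R n | g t. g \<in> carrier G}"
    using interior_mono by (metis (no_types, lifting) subsetD)
  then show ?thesis
    by (simp only: f0)
qed

text \<open>By the neighbourhood lemma a point of \<open>L\<close> near \<open>H\<close> has the form \<open>coadj g H + t n\<close>; as \<open>L\<close> is invariant and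
meets each line in direction \<open>n\<close> at most once, \<open>t = 0\<close>. Hence the orbits are open in \<open>L\<close>, and a connected
set is not a disjoint union of several nonempty open subsets.\<close>

theorem coadjoint_orbit_eq_leaf:
  assumes conn: "connected L" and F: "F \<in> L"
    and invariant: "\<And>g H. g \<in> carrier G \<Longrightarrow> H \<in> L \<Longrightarrow> coadj g H \<in> L"
    and nondeg: "\<And>H z. H \<in> L \<Longrightarrow> (\<And>u. H \<bullet> br u z = 0) \<Longrightarrow> n \<bullet> z = 0 \<Longrightarrow> z = 0"
    and transversal: "\<And>H t. H \<in> L \<Longrightarrow> H + t *\<^sub>R n \<in> L \<Longrightarrow> t = 0"
  shows "coadjoint_orbit \<iota> F = L"
proof
  show "coadjoint_orbit \<iota> F \<subseteq> L"
    using invariant F by (auto simp: coadjoint_orbit_eq)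
  let ?R = "\<lambda>H K. \<exists>g\<in>carrier G. K = coadj g H"
  have "?R F K" if "K \<in> L" for K
  proof (rule connected_equivalence_relation[OF conn F that])
    show "?R K H" if HK: "?R H K" for H K
    proof -
      obtain g where g: "g \<in> carrier G" "K = coadj g H"
        using HK by blast
      then have "coadj (m_inv G g) K = H"
        using coadj_mult[of g "m_inv G g" H] by (simp add: coadj_one)
      then show ?thesis
        using g(1) by blast
    qed
    show "?R H J" if "?R H K" "?R K J" for H K J
      using that coadj_mult by (metis m_closed)
    fix H assume H: "H \<in> L"
    let ?U = "interior {coadj g H + t *\<^sub>R n | g t. g \<in> carrier G}"
    have "?R H K" if K: "K \<in> L \<inter> ?U" for K
    proof -
      have "K \<in> {coadj g H + t *\<^sub>R n | g t. g \<in> carrier G}"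
        using K interior_subset by blast
      then obtain g t where g: "g \<in> carrier G" "K = coadj g H + t *\<^sub>R n"
        by blast
      then have "t = 0"
        using transversal[OF invariant[OF g(1) H]] K by simp
      then show ?thesis
        using g by auto
    qed
    moreover have "openin (top_of_set L) (L \<inter> ?U)"
      by (rule openin_open_Int) simp
    moreover have "H \<in> L \<inter> ?U"
      using orbit_thickened_is_neighbourhood[OF nondeg[OF H]] H by blast
    ultimately show "\<exists>T. openin (top_of_set L) T \<and> H \<in> T \<and> (\<forall>K\<in>T. ?R H K)"
      by blast
  qed
  then show "L \<subseteq> coadjoint_orbit \<iota> F"
    by (auto simp: coadjoint_orbit_eq)
qed

end

section \<open>Straightening a foliation by graphs over the second coordinate\<close>

text \<open>The four open subsets of \<open>V\<close> given by the signs of \<open>x\<^sub>4\<close> and \<open>x\<^sub>5\<close> are numbered by \<open>2 a + b\<close>, where \<open>a\<close> and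
\<open>b\<close> are \<open>1\<close> for a negative sign; \<open>sign4\<close> and \<open>sign5\<close> recover the signs from the number.\<close>

definition quadrant :: "real^7 \<Rightarrow> nat" where
  "quadrant F = (if F $ 4 > 0 then 0 else 2) + (if F $ 5 > 0 then 0 else 1)"

definition sign4 :: "nat \<Rightarrow> real" where
  "sign4 i = (if i < 2 then 1 else -1)"

definition sign5 :: "nat \<Rightarrow> real" where
  "sign5 i = (if even i then 1 else -1)"

lemma quadrant_less: "quadrant F < 4"
  by (simp add: quadrant_def)

lemma quadrant_component:
  assumes "i < 4"
  shows "{F \<in> V. quadrant F = i} = {F. 0 < sign4 i * F $ 4 \<and> 0 < sign5 i * F $ 5}"
proof -
  have "i = 0 \<or> i = 1 \<or> i = 2 \<or> i = 3"
    using assms by linarith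
  then show ?thesis
    by (elim disjE) (auto simp: V_def quadrant_def sign4_def sign5_def split: if_splits)
qed

lemma sign_quadrant:
  assumes "F \<in> V"
  shows "sign4 (quadrant F) * \<bar>F $ 4\<bar> = F $ 4" "sign5 (quadrant F) * \<bar>F $ 5\<bar> = F $ 5"
  using assms by (auto simp: V_def quadrant_def sign4_def sign5_def)

definition set2 :: "real^7 \<Rightarrow> real \<Rightarrow> real^7" where
  "set2 F t = F + (t - F $ 2) *\<^sub>R axis 2 1"

lemma set2_nth: "set2 F t $ i = (if i = 2 then t else F $ i)"
  by (simp add: set2_def axis_def)

lemma set2_set2: "set2 (set2 F s) t = set2 F t"
  and set2_id: "set2 F (F $ 2) = F"
  by (simp_all add: vec_eq_iff set2_nth)

lemma set2_in_V: "set2 F t \<in> V \<longleftrightarrow> F \<in> V"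
  and quadrant_set2: "quadrant (set2 F t) = quadrant F"
  by (simp_all add: V_def quadrant_def set2_nth)

definition leaf :: "(real^7 \<Rightarrow> real) \<Rightarrow> nat \<times> real \<Rightarrow> (real^7) set" where
  "leaf P b = {F \<in> V. (quadrant F, P F) = b}"

text \<open>Replacing \<open>x\<^sub>2\<close> by \<open>P\<close> is a change of coordinates on \<open>V\<close>, with inverse \<open>k\<close>. It carries the level sets of \<open>P\<close>
to those of \<open>x\<^sub>2\<close>, which do not depend on \<open>P\<close>; so all questions on the topology of the foliation are
reduced to the single function \<open>x\<^sub>2\<close>.\<close>

definition straightens :: "(real^7 \<Rightarrow> real) \<Rightarrow> (real^7 \<Rightarrow> real^7) \<Rightarrow> bool" where
  "straightens P k \<longleftrightarrow> homeomorphism V V (\<lambda>F. set2 F (P F)) k"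

text \<open>On a line parallel to the \<open>x\<^sub>2\<close>-axis \<open>P\<close> is affine with nonzero slope, and \<open>P = s\<close> can be solved for
\<open>x\<^sub>2\<close>.\<close>

lemma straightens_affine:
  assumes cont: "continuous_on V a" "continuous_on V b"
    and a: "\<And>F. F \<in> V \<Longrightarrow> a F \<noteq> 0"
    and indep: "\<And>F t. a (set2 F t) = a F" "\<And>F t. b (set2 F t) = b F"
    and P: "\<And>F. F \<in> V \<Longrightarrow> P F = a F * F $ 2 + b F"
  shows "straightens P (\<lambda>F. set2 F ((F $ 2 - b F) / a F))"
  unfolding straightens_def
proof (rule homeomorphismI)
  have "continuous_on V (\<lambda>F. set2 F (a F * F $ 2 + b F))"
    unfolding set2_def by (intro continuous_intros cont)
  then show "continuous_on V (\<lambda>F. set2 F (P F))"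
    by (rule continuous_on_eq) (simp add: P)
  show "continuous_on V (\<lambda>F. set2 F ((F $ 2 - b F) / a F))"
    unfolding set2_def using a by (intro continuous_intros cont) auto
qed (use a in \<open>auto simp: set2_in_V set2_set2 set2_nth indep P set2_id\<close>)

lemma straightens_image_leaf:
  assumes "straightens P k"
  shows "(\<lambda>F. set2 F (P F)) ` leaf P b = leaf (\<lambda>F. F $ 2) b"
    and "k ` leaf (\<lambda>F. F $ 2) b = leaf P b"
proof -
  let ?h = "\<lambda>F. set2 F (P F)"
  have hom: "?h ` V = V" "k ` V = V" "\<And>F. F \<in> V \<Longrightarrow> k (?h F) = F" "\<And>F. F \<in> V \<Longrightarrow> ?h (k F) = F"
    using assms by (auto simp: straightens_def homeomorphism_def)
  have iff: "?h F \<in> leaf (\<lambda>F. F $ 2) b \<longleftrightarrow> F \<in> leaf P b" for F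
    by (simp add: leaf_def set2_in_V quadrant_set2 set2_nth)
  have sub: "leaf Q b \<subseteq> V" for Q
    by (auto simp: leaf_def)
  have "k F \<in> leaf P b" if "F \<in> leaf (\<lambda>F. F $ 2) b" for F
  proof -
    have "F \<in> V"
      using that sub by blast
    then show ?thesis
      using that iff[of "k F"] hom(4) by simp
  qed
  moreover have "F \<in> k ` leaf (\<lambda>F. F $ 2) b" if "F \<in> leaf P b" for F
    using that iff[of F] hom(3)[of F] sub by (metis image_eqI subsetD)
  ultimately show 1: "k ` leaf (\<lambda>F. F $ 2) b = leaf P b"
    by blast
  show "?h ` leaf P b = leaf (\<lambda>F. F $ 2) b"
    unfolding 1[symmetric] image_image using hom(4) sub by (metis (no_types, lifting) image_cong image_ident subsetD)
qed

text \<open>A level set of \<open>x\<^sub>2\<close> in a quadrant is an intersection of half spaces and a hyperplane, so it is convex.\<close>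

lemma connected_flat_leaf:
  assumes "i < 4"
  shows "connected (leaf (\<lambda>F. F $ 2) (i, c))"
proof -
  have "leaf (\<lambda>F. F $ 2) (i, c) =
      {F. 0 < sign4 i * F $ 4 \<and> 0 < sign5 i * F $ 5} \<inter> {F. F $ 2 = c}"
    using quadrant_component[OF assms] by (auto simp: leaf_def)
  moreover have "convex {F::real^7. 0 < s * F $ j}" for s j
  proof -
    have "{F::real^7. 0 < s * F $ j} = {F. (s *\<^sub>R axis j 1) \<bullet> F > 0}"
      by (simp add: inner_axis inner_commute)
    then show ?thesis
      by (simp only: convex_halfspace_gt)
  qed
  moreover have "convex {F::real^7. F $ 2 = c}"
  proof -
    have "{F::real^7. F $ 2 = c} = {F. axis 2 1 \<bullet> F = c}"
      by (simp add: inner_axis inner_commute)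
    then show ?thesis
      by (simp only: convex_hyperplane)
  qed
  ultimately show ?thesis
    by (simp add: convex_connected convex_Int Collect_conj_eq)
qed

lemma connected_leaf:
  assumes "straightens P k" "i < 4"
  shows "connected (leaf P (i, c))"
proof -
  have "continuous_on V k"
    using assms(1) by (auto simp: straightens_def homeomorphism_def)
  then have "continuous_on (leaf (\<lambda>F. F $ 2) (i, c)) k"
    by (rule continuous_on_subset) (auto simp: leaf_def)
  then show ?thesis
    using connected_continuous_image connected_flat_leaf[OF assms(2)]
      straightens_image_leaf(2)[OF assms(1)] by metis
qed

text \<open>Straighten the first foliation and undo the straightening of the second.\<close>

lemma straightened_foliations_equivalent:
  assumes "straightens P k" "straightens P' k'"
  shows "topologically_equivalent (V, leaf P ` B) (V, leaf P' ` B)"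
proof -
  have "homeomorphism V V (\<lambda>F. set2 F (P F)) k" "homeomorphism V V k' (\<lambda>F. set2 F (P' F))"
    using assms homeomorphism_symD unfolding straightens_def by blast+
  then have hom: "homeomorphism V V (k' \<circ> (\<lambda>F. set2 F (P F))) (k \<circ> (\<lambda>F. set2 F (P' F)))"
    by (rule homeomorphism_compose)
  have "(k' \<circ> (\<lambda>F. set2 F (P F))) ` leaf P b = leaf P' b" for b
    by (simp only: image_comp[symmetric] straightens_image_leaf[OF assms(1)]
        straightens_image_leaf[OF assms(2)])
  then have "\<forall>L \<in> leaf P ` B. (k' \<circ> (\<lambda>F. set2 F (P F))) ` L \<in> leaf P' ` B"
    by (metis (no_types, lifting) imageE imageI)
  then show ?thesis
    unfolding topologically_equivalent_def prod.case using hom by blast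
qed

section \<open>The foliation as a trivial fibration over four lines\<close>

lemma topspace_four_lines: "topspace four_lines = {..<4} \<times> UNIV"
  by (auto simp: four_lines_def topspace_sum_topology)

lemma openin_four_lines: "openin four_lines U \<longleftrightarrow> U \<subseteq> {..<4} \<times> UNIV \<and> (\<forall>i<4. open {t. (i, t) \<in> U})"
  by (auto simp: four_lines_def openin_sum_topology)

lemma continuous_map_from_four_lines:
  fixes f :: "nat \<times> real \<Rightarrow> 'a::topological_space"
  assumes "\<And>i. i < 4 \<Longrightarrow> continuous_on UNIV (\<lambda>t. f (i, t))"
  shows "continuous_map four_lines euclidean f"
  unfolding continuous_map_def
proof (intro conjI allI impI)
  fix U :: "'a set" assume "openin euclidean U"
  then have "open ((\<lambda>t. f (i, t)) -` U)" if "i < 4" for i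
    using assms[OF that] by (simp add: open_vimage)
  then show "openin four_lines {b \<in> topspace four_lines. f b \<in> U}"
    by (auto simp: openin_four_lines topspace_four_lines vimage_def)
qed simp

lemma continuous_map_into_four_lines:
  assumes range: "\<And>F. F \<in> S \<Longrightarrow> fst (f F) < 4"
    and pieces: "\<And>i. i < 4 \<Longrightarrow> openin (top_of_set S) {F \<in> S. fst (f F) = i}"
    and cont: "continuous_on S (\<lambda>F. snd (f F))"
  shows "continuous_map (top_of_set S) four_lines f"
  unfolding continuous_map_def
proof (intro conjI allI impI)
  show "f \<in> topspace (top_of_set S) \<rightarrow> topspace four_lines"
    using range by (auto simp: topspace_four_lines mem_Times_iff)
  fix U assume U: "openin four_lines U"
  have "openin (top_of_set S) ({F \<in> S. fst (f F) = i} \<inter> (S \<inter> (\<lambda>F. snd (f F)) -` {t. (i, t) \<in> U}))"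
    if "i < 4" for i
    using pieces[OF that] U that
    by (intro openin_Int continuous_openin_preimage_gen cont) (auto simp: openin_four_lines)
  then have "openin (top_of_set S)
      (\<Union>i<4. {F \<in> S. fst (f F) = i} \<inter> (S \<inter> (\<lambda>F. snd (f F)) -` {t. (i, t) \<in> U}))"
    by blast
  also have "(\<Union>i<4. {F \<in> S. fst (f F) = i} \<inter> (S \<inter> (\<lambda>F. snd (f F)) -` {t. (i, t) \<in> U})) =
      {F \<in> topspace (top_of_set S). f F \<in> U}"
    using range by (auto simp: prod_eq_iff)
  finally show "openin (top_of_set S) {F \<in> topspace (top_of_set S). f F \<in> U}" .
qed

text \<open>The fibre of the trivialisation: the coordinates left after the quadrant and the value of \<open>x\<^sub>2\<close> have been
recorded, that is \<open>x\<^sub>1, x\<^sub>3, x\<^sub>6, x\<^sub>7\<close> and the absolute values of \<open>x\<^sub>4\<close> and \<open>x\<^sub>5\<close>.\<close>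

definition positive_slice :: "(real^7) set" where
  "positive_slice = {E. E $ 2 = 0 \<and> 0 < E $ 4 \<and> 0 < E $ 5}"

definition to_positive_quadrant :: "real^7 \<Rightarrow> real^7" where
  "to_positive_quadrant F = (\<chi> i. if i = 2 then 0 else if i = 4 \<or> i = 5 then \<bar>F $ i\<bar> else F $ i)"

definition to_quadrant :: "real \<times> real \<times> real \<Rightarrow> real^7 \<Rightarrow> real^7" where
  "to_quadrant = (\<lambda>(s, r, t) E. \<chi> i. if i = 2 then t else if i = 4 then s * E $ 4
      else if i = 5 then r * E $ 5 else E $ i)"

lemma flat_trivialisation:
  "homeomorphic_map (top_of_set V) (prod_topology four_lines (top_of_set positive_slice))
     (\<lambda>F. ((quadrant F, F $ 2), to_positive_quadrant F))"
proof -
  let ?\<Phi> = "\<lambda>F. ((quadrant F, F $ 2), to_positive_quadrant F)"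
  let ?\<Psi> = "\<lambda>(b, E). to_quadrant (sign4 (fst b), sign5 (fst b), snd b) E"
  have "continuous_map (top_of_set V) four_lines (\<lambda>F. (quadrant F, F $ 2))"
  proof (rule continuous_map_into_four_lines)
    fix i :: nat assume i: "i < 4"
    have "open {F::real^7. 0 < sign4 i * F $ 4 \<and> 0 < sign5 i * F $ 5}"
      by (intro open_Collect_conj open_Collect_less continuous_intros)
    then show "openin (top_of_set V) {F \<in> V. fst (quadrant F, F $ 2) = i}"
      using quadrant_component[OF i] by (auto intro!: open_subset)
  qed (auto simp: quadrant_less intro!: continuous_intros)
  moreover have "continuous_map (top_of_set V) (top_of_set positive_slice) to_positive_quadrant"
  proof -
    have "continuous_on V to_positive_quadrant"
      unfolding to_positive_quadrant_def
    proof (rule continuous_on_vec_lambda)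
      fix i :: 7
      show "continuous_on V (\<lambda>F. if i = 2 then 0 else if i = 4 \<or> i = 5 then \<bar>F $ i\<bar> else F $ i)"
        by (cases "i = 2"; cases "i = 4 \<or> i = 5"; simp; intro continuous_intros)
    qed
    then show ?thesis
      by (auto simp: positive_slice_def to_positive_quadrant_def V_def)
  qed
  ultimately have \<Phi>: "continuous_map (top_of_set V) (prod_topology four_lines (top_of_set positive_slice)) ?\<Phi>"
    by (rule continuous_map_pairedI)
  \<comment> \<open>The inverse depends on the number of the quadrant only through the two signs, so it factors through
    a continuous map between Euclidean spaces.\<close>
  have "continuous_map four_lines euclidean (\<lambda>b. (sign4 (fst b), sign5 (fst b), snd b))"
    by (rule continuous_map_from_four_lines) (auto intro!: continuous_intros)
  then have "continuous_map (prod_topology four_lines (top_of_set positive_slice)) (prod_topology euclidean euclidean)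
      (\<lambda>(b, E). ((sign4 (fst b), sign5 (fst b), snd b), E))"
    unfolding continuous_map_prod_top by simp
  moreover have "continuous_map euclidean euclidean (\<lambda>(x, E). to_quadrant x E)"
  proof -
    have "continuous_on UNIV (\<lambda>p :: (real \<times> real \<times> real) \<times> (real^7). if i = 2 then snd (snd (fst p)) else if i = 4 then fst (fst p) * snd p $ 4
        else if i = 5 then fst (snd (fst p)) * snd p $ 5 else snd p $ i)"
      for i :: 7
      by (cases "i = 2"; cases "i = 4"; cases "i = 5"; simp; intro continuous_intros)
    then show ?thesis
      by (simp add: to_quadrant_def case_prod_beta continuous_on_vec_lambda)
  qed
  ultimately have "continuous_map (prod_topology four_lines (top_of_set positive_slice)) euclidean
      ((\<lambda>(x, E). to_quadrant x E) \<circ> (\<lambda>(b, E). ((sign4 (fst b), sign5 (fst b), snd b), E)))"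
    unfolding prod_topology_euclidean by (rule continuous_map_compose)
  then have \<Psi>_cont: "continuous_map (prod_topology four_lines (top_of_set positive_slice)) euclidean ?\<Psi>"
    by (simp add: o_def case_prod_unfold)
  have \<Psi>_quadrant: "?\<Psi> ((i, t), E) \<in> V \<and> quadrant (?\<Psi> ((i, t), E)) = i"
    if "i < 4" "E \<in> positive_slice" for i t E
  proof -
    have "?\<Psi> ((i, t), E) \<in> {F. 0 < sign4 i * F $ 4 \<and> 0 < sign5 i * F $ 5}"
      using that by (auto simp: to_quadrant_def positive_slice_def sign4_def sign5_def)
    then show ?thesis
      using quadrant_component[OF that(1)] by blast
  qed
  have \<Psi>: "continuous_map (prod_topology four_lines (top_of_set positive_slice)) (top_of_set V) ?\<Psi>"
    using \<Psi>_cont \<Psi>_quadrant by (auto simp: continuous_map_in_subtopology topspace_four_lines)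
  have "?\<Psi> (?\<Phi> F) = F" if "F \<in> V" for F
    using sign_quadrant[OF that] by (simp add: vec_eq_iff to_quadrant_def to_positive_quadrant_def)
  moreover have "?\<Phi> (?\<Psi> p) = p" if p_in: "p \<in> topspace (prod_topology four_lines (top_of_set positive_slice))" for p
  proof -
    obtain i t E where p: "p = ((i, t), E)" "i < 4" "E \<in> positive_slice"
      using p_in by (cases p) (auto simp: topspace_four_lines)
    have "to_positive_quadrant (?\<Psi> p) = E"
      using p(3) by (auto simp: p(1) vec_eq_iff to_quadrant_def to_positive_quadrant_def positive_slice_def abs_mult sign4_def sign5_def)
    moreover have "?\<Psi> p $ 2 = t"
      by (simp add: p(1) to_quadrant_def)
    moreover have "quadrant (?\<Psi> p) = i"
      using \<Psi>_quadrant p by blast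
    ultimately show ?thesis
      by (simp only: p(1))
  qed
  ultimately have "homeomorphic_maps (top_of_set V) (prod_topology four_lines (top_of_set positive_slice)) ?\<Phi> ?\<Psi>"
    unfolding homeomorphic_maps_def using \<Phi> \<Psi> by simp
  then show ?thesis
    by (simp add: homeomorphic_maps_map)
qed

lemma straightened_trivial_fibration:
  assumes "straightens P k"
  shows "trivial_fibration (top_of_set V) four_lines (\<lambda>F. (quadrant F, P F))"
  unfolding trivial_fibration_def
proof (intro exI conjI)
  let ?h = "\<lambda>F. set2 F (P F)"
  have "(\<chi> i. if i = 2 then 0 else 1) \<in> positive_slice"
    by (simp add: positive_slice_def)
  then show "topspace (top_of_set positive_slice) \<noteq> {}"
    by auto
  have "homeomorphic_maps (top_of_set V) (top_of_set V) ?h k"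
    using assms by (auto simp: straightens_def homeomorphism_def homeomorphic_maps_def)
  then have "homeomorphic_map (top_of_set V) (top_of_set V) ?h"
    by (simp add: homeomorphic_maps_map)
  then show "homeomorphic_map (top_of_set V) (prod_topology four_lines (top_of_set positive_slice))
      ((\<lambda>F. ((quadrant F, F $ 2), to_positive_quadrant F)) \<circ> ?h)"
    by (rule homeomorphic_map_compose[OF _ flat_trivialisation])
  show "\<forall>F\<in>topspace (top_of_set V). fst (((\<lambda>F. ((quadrant F, F $ 2), to_positive_quadrant F)) \<circ> ?h) F) = (quadrant F, P F)"
    by (simp add: quadrant_set2 set2_nth)
qed

section \<open>The invariants of the five families\<close>

lemma UNIV_7: "(UNIV :: 7 set) = {1, 2, 3, 4, 5, 6, 7}"
  by (rule sym, rule card_subset_eq) simp_all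

lemma forall_7: "(\<forall>i::7. P i) \<longleftrightarrow> P 1 \<and> P 2 \<and> P 3 \<and> P 4 \<and> P 5 \<and> P 6 \<and> P 7"
  using UNIV_7 by (metis (no_types, opaque_lifting) UNIV_I empty_iff insert_iff)

lemma axis_nth_if: "axis i x $ j = (if i = j then x else 0)"
  by (simp add: axis_def)

lemma bracket_of_nth:
  "bracket_of tab u z $ k = (\<Sum>(i, j, w) \<leftarrow> tab. (u $ i * z $ j - u $ j * z $ i) * w $ k)"
  by (induction tab) (auto simp: bracket_of_def)

lemma inner_bracket_of:
  "F \<bullet> bracket_of tab u z = (\<Sum>(i, j, w) \<leftarrow> tab. (u $ i * z $ j - u $ j * z $ i) * (F \<bullet> w))"
  by (induction tab) (auto simp: bracket_of_def inner_add_right)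

lemmas gmd_bracket_simps =
  g2_def g3_def g4_00_def g9_def g10_def bracket_of_nth inner_bracket_of
  inner_axis inner_add_right axis_nth_if

text \<open>What the proof needs of an invariant \<open>P\<close> of the algebra \<open>br\<close>. The second condition makes \<open>V\<close> stable
under the group. The third says that the gradient of \<open>P\<close> lies in the radical of the Kirillov form
\<open>(u, z) \<mapsto> \<langle>F, [u, z]\<rangle>\<close>, so that \<open>P\<close> is constant along the orbits; the fourth, that this radical meets the
hyperplane \<open>z\<^sub>2 = 0\<close> trivially, so that the orbit has codimension at most one and is transversal to the
\<open>x\<^sub>2\<close>-axis.\<close>

definition gmd_invariant :: "(real^7 \<Rightarrow> real^7 \<Rightarrow> real^7) \<Rightarrow> (real^7 \<Rightarrow> real) \<Rightarrow> bool" where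
  "gmd_invariant br P \<longleftrightarrow>
     (\<exists>k. straightens P k) \<and>
     (\<forall>j\<in>{4, 5}. \<exists>a. \<forall>u. br u (bv j) = a u *\<^sub>R bv j) \<and>
     (\<forall>F\<in>V. \<exists>D. (P has_derivative (\<lambda>H. H \<bullet> D)) (at F) \<and> (\<forall>u. F \<bullet> br u D = 0)) \<and>
     (\<forall>F\<in>V. \<forall>z. (\<forall>u. F \<bullet> br u z = 0) \<longrightarrow> z $ 2 = 0 \<longrightarrow> z = 0)"

definition gradient :: "real \<Rightarrow> real \<Rightarrow> real \<Rightarrow> real \<Rightarrow> real^7" where
  "gradient c2 c3 c4 c5 = c2 *\<^sub>R bv 2 + c3 *\<^sub>R bv 3 + c4 *\<^sub>R bv 4 + c5 *\<^sub>R bv 5"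

lemma inner_gradient: "H \<bullet> gradient c2 c3 c4 c5 = c2 * H $ 2 + c3 * H $ 3 + c4 * H $ 4 + c5 * H $ 5"
  by (simp add: gradient_def inner_add_right inner_axis)

lemma gradient_nth: "gradient c2 c3 c4 c5 $ i =
    (if i = 2 then c2 else if i = 3 then c3 else if i = 4 then c4 else if i = 5 then c5 else 0)"
  by (auto simp: gradient_def axis_nth_if)

lemma gmd_invariantI:
  assumes affine: "continuous_on V a" "continuous_on V b"
      "\<And>F. F \<in> V \<Longrightarrow> a F \<noteq> 0" "\<And>F t. a (set2 F t) = a F" "\<And>F t. b (set2 F t) = b F"
      "\<And>F. F \<in> V \<Longrightarrow> P F = a F * F $ 2 + b F"
    and eigen: "\<And>u. br u (bv 4) = e4 u *\<^sub>R bv 4" "\<And>u. br u (bv 5) = e5 u *\<^sub>R bv 5"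
    and deriv: "\<And>F. F \<in> V \<Longrightarrow> (P has_derivative
        (\<lambda>H. c2 F * H $ 2 + c3 F * H $ 3 + c4 F * H $ 4 + c5 F * H $ 5)) (at F)"
    and radical: "\<And>F u. F \<in> V \<Longrightarrow> F \<bullet> br u (gradient (c2 F) (c3 F) (c4 F) (c5 F)) = 0"
    and nondeg: "\<And>F z. F \<in> V \<Longrightarrow> (\<And>u. F \<bullet> br u z = 0) \<Longrightarrow> z $ 2 = 0 \<Longrightarrow> z = 0"
  shows "gmd_invariant br P"
  unfolding gmd_invariant_def
proof (intro conjI)
  show "\<exists>k. straightens P k"
    using straightens_affine[OF affine] by blast
  show "\<forall>j\<in>{4, 5}. \<exists>a. \<forall>u. br u (bv j) = a u *\<^sub>R bv j"
    using eigen by blast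
  show "\<forall>F\<in>V. \<exists>D. (P has_derivative (\<lambda>H. H \<bullet> D)) (at F) \<and> (\<forall>u. F \<bullet> br u D = 0)"
    using deriv radical unfolding inner_gradient[symmetric] by blast
  show "\<forall>F\<in>V. \<forall>z. (\<forall>u. F \<bullet> br u z = 0) \<longrightarrow> z $ 2 = 0 \<longrightarrow> z = 0"
    using nondeg by blast
qed

lemma has_derivative_nth: "((\<lambda>F::real^'n::finite. F $ i) has_derivative (\<lambda>H. H $ i)) (at F)"
  by (rule bounded_linear_imp_has_derivative[OF bounded_linear_vec_nth])

lemma has_derivative_ln_abs:
  assumes "(f has_derivative f') (at x)" "f x \<noteq> (0::real)"
  shows "((\<lambda>y. ln \<bar>f y\<bar>) has_derivative (\<lambda>h. f' h / f x)) (at x)"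
proof -
  have eq: "ln \<bar>f y\<bar> = ln ((f y)\<^sup>2) / 2" for y
    using ln_realpow[of "\<bar>f y\<bar>" 2] by (cases "f y = 0") auto
  have "0 < f x * f x"
    using assms(2) by (metis not_real_square_gt_zero)
  then have "((\<lambda>y. ln ((f y)\<^sup>2) / 2) has_derivative (\<lambda>h. f' h / f x)) (at x)"
    using assms(2) by (auto intro!: derivative_eq_intros assms(1) simp: fun_eq_iff field_simps power2_eq_square)
  then show ?thesis
    by (simp only: eq)
qed

lemma V_nonzero: "F \<in> V \<Longrightarrow> F $ 4 \<noteq> 0" "F \<in> V \<Longrightarrow> F $ 5 \<noteq> 0"
  by (simp_all add: V_def)

text \<open>The formulas for \<open>P\<close> are found by solving \<open>\<langle>F, [u, z]\<rangle> = 0\<close> for \<open>z\<close>: the radical is a line, its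
components \<open>z\<^sub>1, z\<^sub>6, z\<^sub>7\<close> vanish and \<open>z\<^sub>2 : z\<^sub>3 = - x\<^sub>5 : x\<^sub>4\<close>. This makes \<open>P\<close> a function of \<open>x\<^sub>2, \<dots>, x\<^sub>5\<close> that is
\<open>x\<^sub>3 / x\<^sub>5 - x\<^sub>2 / x\<^sub>4\<close> up to a factor and a summand depending on \<open>x\<^sub>4, x\<^sub>5\<close> only. The weights of \<open>X\<close> and \<open>Y\<close> fix the
factor, here \<open>x\<^sub>4\<close>; for \<open>g9\<close> and \<open>g10\<close> the terms \<open>[Y, X\<^sub>3] = \<dots> + X\<^sub>5\<close> produce the logarithms.\<close>

lemma gmd_invariant_g2: "gmd_invariant g2 (\<lambda>F. F $ 3 * F $ 4 / F $ 5 - F $ 2)"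
proof (rule gmd_invariantI)
  show "continuous_on V (\<lambda>F::real^7. - 1 :: real)" "continuous_on V (\<lambda>F. F $ 3 * F $ 4 / F $ 5)"
    by (auto intro!: continuous_intros simp: V_nonzero)
  show "g2 u (bv 4) = u $ 6 *\<^sub>R bv 4" "g2 u (bv 5) = (u $ 6 + u $ 7) *\<^sub>R bv 5" for u
    by (simp_all add: vec_eq_iff forall_7 gmd_bracket_simps)
  fix F assume F: "F \<in> V"
  show "((\<lambda>F. F $ 3 * F $ 4 / F $ 5 - F $ 2) has_derivative
      (\<lambda>H. - 1 * H $ 2 + (F $ 4 / F $ 5) * H $ 3 + (F $ 3 / F $ 5) * H $ 4
        + - (F $ 3 * F $ 4 / (F $ 5)\<^sup>2) * H $ 5)) (at F)"
    using V_nonzero[OF F]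
    by (auto intro!: derivative_eq_intros has_derivative_nth simp: fun_eq_iff field_simps power2_eq_square)
  show "F \<bullet> g2 u (gradient (- 1) (F $ 4 / F $ 5) (F $ 3 / F $ 5) (- (F $ 3 * F $ 4 / (F $ 5)\<^sup>2))) = 0" for u
    using V_nonzero[OF F] by (simp add: gmd_bracket_simps gradient_nth field_simps power2_eq_square)
  fix z assume h: "\<And>u. F \<bullet> g2 u z = 0" and "z $ 2 = 0"
  then show "z = 0"
    using h[of "bv 1"] h[of "bv 2"] h[of "bv 3"] h[of "bv 4"] h[of "bv 5"] h[of "bv 6"] h[of "bv 7"]
      V_nonzero[OF F] by (auto simp: gmd_bracket_simps vec_eq_iff forall_7)
qed (auto simp: set2_nth)

lemma has_derivative_ratio_difference:
  assumes "F \<in> V"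
  shows "((\<lambda>F. F $ 3 / F $ 5 - F $ 2 / F $ 4) has_derivative
      (\<lambda>H. (- 1 / F $ 4) * H $ 2 + (1 / F $ 5) * H $ 3 + (F $ 2 / (F $ 4)\<^sup>2) * H $ 4
        + - (F $ 3 / (F $ 5)\<^sup>2) * H $ 5)) (at F)"
  using V_nonzero[OF assms]
  by (auto intro!: derivative_eq_intros has_derivative_nth simp: fun_eq_iff field_simps power2_eq_square)

lemma gmd_invariant_g3: "gmd_invariant g3 (\<lambda>F. F $ 3 / F $ 5 - F $ 2 / F $ 4)"
proof (rule gmd_invariantI)
  show "continuous_on V (\<lambda>F. - 1 / F $ 4)" "continuous_on V (\<lambda>F. F $ 3 / F $ 5)"
    by (auto intro!: continuous_intros simp: V_nonzero)
  show "g3 u (bv 4) = u $ 6 *\<^sub>R bv 4" "g3 u (bv 5) = u $ 7 *\<^sub>R bv 5" for u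
    by (simp_all add: vec_eq_iff forall_7 gmd_bracket_simps)
  fix F assume F: "F \<in> V"
  show "((\<lambda>F. F $ 3 / F $ 5 - F $ 2 / F $ 4) has_derivative
      (\<lambda>H. (- 1 / F $ 4) * H $ 2 + (1 / F $ 5) * H $ 3 + (F $ 2 / (F $ 4)\<^sup>2) * H $ 4
        + - (F $ 3 / (F $ 5)\<^sup>2) * H $ 5)) (at F)"
    by (rule has_derivative_ratio_difference[OF F])
  show "F \<bullet> g3 u (gradient (- 1 / F $ 4) (1 / F $ 5) (F $ 2 / (F $ 4)\<^sup>2) (- (F $ 3 / (F $ 5)\<^sup>2))) = 0" for u
    using V_nonzero[OF F] by (simp add: gmd_bracket_simps gradient_nth field_simps power2_eq_square)
  fix z assume h: "\<And>u. F \<bullet> g3 u z = 0" and "z $ 2 = 0"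
  then show "z = 0"
    using h[of "bv 1"] h[of "bv 2"] h[of "bv 3"] h[of "bv 4"] h[of "bv 5"] h[of "bv 6"] h[of "bv 7"]
      V_nonzero[OF F] by (auto simp: gmd_bracket_simps vec_eq_iff forall_7)
qed (auto simp: set2_nth V_nonzero)

lemma gmd_invariant_g4_00: "gmd_invariant g4_00 (\<lambda>F. F $ 3 - F $ 2 * F $ 5 / F $ 4)"
proof (rule gmd_invariantI)
  show "continuous_on V (\<lambda>F. - (F $ 5 / F $ 4))" "continuous_on V (\<lambda>F. F $ 3)"
    by (auto intro!: continuous_intros simp: V_nonzero)
  show "g4_00 u (bv 4) = (u $ 6 + u $ 7) *\<^sub>R bv 4" "g4_00 u (bv 5) = u $ 6 *\<^sub>R bv 5" for u
    by (simp_all add: vec_eq_iff forall_7 gmd_bracket_simps)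
  fix F assume F: "F \<in> V"
  show "((\<lambda>F. F $ 3 - F $ 2 * F $ 5 / F $ 4) has_derivative
      (\<lambda>H. - (F $ 5 / F $ 4) * H $ 2 + 1 * H $ 3 + (F $ 2 * F $ 5 / (F $ 4)\<^sup>2) * H $ 4
        + - (F $ 2 / F $ 4) * H $ 5)) (at F)"
    using V_nonzero[OF F]
    by (auto intro!: derivative_eq_intros has_derivative_nth simp: fun_eq_iff field_simps power2_eq_square)
  show "F \<bullet> g4_00 u (gradient (- (F $ 5 / F $ 4)) 1 (F $ 2 * F $ 5 / (F $ 4)\<^sup>2) (- (F $ 2 / F $ 4))) = 0" for u
    using V_nonzero[OF F] by (simp add: gmd_bracket_simps gradient_nth field_simps power2_eq_square)
  fix z assume h: "\<And>u. F \<bullet> g4_00 u z = 0" and "z $ 2 = 0"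
  then show "z = 0"
    using h[of "bv 1"] h[of "bv 2"] h[of "bv 3"] h[of "bv 4"] h[of "bv 5"] h[of "bv 6"] h[of "bv 7"]
      V_nonzero[OF F] by (auto simp: gmd_bracket_simps vec_eq_iff forall_7)
qed (auto simp: set2_nth V_nonzero)

lemma gmd_invariant_g9: "gmd_invariant g9 (\<lambda>F. F $ 3 / F $ 5 - F $ 2 / F $ 4 - ln \<bar>F $ 4\<bar>)"
proof (rule gmd_invariantI)
  show "continuous_on V (\<lambda>F. - 1 / F $ 4)" "continuous_on V (\<lambda>F. F $ 3 / F $ 5 - ln \<bar>F $ 4\<bar>)"
    by (auto intro!: continuous_intros simp: V_nonzero)
  show "g9 u (bv 4) = u $ 7 *\<^sub>R bv 4" "g9 u (bv 5) = u $ 6 *\<^sub>R bv 5" for u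
    by (simp_all add: vec_eq_iff forall_7 gmd_bracket_simps)
  fix F assume F: "F \<in> V"
  show "((\<lambda>F. F $ 3 / F $ 5 - F $ 2 / F $ 4 - ln \<bar>F $ 4\<bar>) has_derivative
      (\<lambda>H. (- 1 / F $ 4) * H $ 2 + (1 / F $ 5) * H $ 3 + (F $ 2 / (F $ 4)\<^sup>2 - 1 / F $ 4) * H $ 4
        + - (F $ 3 / (F $ 5)\<^sup>2) * H $ 5)) (at F)"
    by (rule has_derivative_eq_rhs[OF has_derivative_diff[OF has_derivative_ratio_difference[OF F]
          has_derivative_ln_abs[OF has_derivative_nth V_nonzero(1)[OF F]]]])
       (simp add: fun_eq_iff algebra_simps)
  show "F \<bullet> g9 u (gradient (- 1 / F $ 4) (1 / F $ 5) (F $ 2 / (F $ 4)\<^sup>2 - 1 / F $ 4) (- (F $ 3 / (F $ 5)\<^sup>2))) = 0" for u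
    using V_nonzero[OF F] by (simp add: gmd_bracket_simps gradient_nth field_simps power2_eq_square)
  fix z assume h: "\<And>u. F \<bullet> g9 u z = 0" and "z $ 2 = 0"
  then show "z = 0"
    using h[of "bv 1"] h[of "bv 2"] h[of "bv 3"] h[of "bv 4"] h[of "bv 5"] h[of "bv 6"] h[of "bv 7"]
      V_nonzero[OF F] by (auto simp: gmd_bracket_simps vec_eq_iff forall_7)
qed (auto simp: set2_nth V_nonzero)

lemma gmd_invariant_g10:
  "gmd_invariant (g10 l) (\<lambda>F. F $ 3 / F $ 5 - F $ 2 / F $ 4 - ln \<bar>F $ 5\<bar> + l * ln \<bar>F $ 4\<bar>)"
proof (rule gmd_invariantI)
  show "continuous_on V (\<lambda>F. - 1 / F $ 4)" "continuous_on V (\<lambda>F. F $ 3 / F $ 5 - ln \<bar>F $ 5\<bar> + l * ln \<bar>F $ 4\<bar>)"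
    by (auto intro!: continuous_intros simp: V_nonzero)
  show "g10 l u (bv 4) = u $ 6 *\<^sub>R bv 4" "g10 l u (bv 5) = (l * u $ 6 + u $ 7) *\<^sub>R bv 5" for u
    by (simp_all add: vec_eq_iff forall_7 gmd_bracket_simps)
  fix F assume F: "F \<in> V"
  show "((\<lambda>F. F $ 3 / F $ 5 - F $ 2 / F $ 4 - ln \<bar>F $ 5\<bar> + l * ln \<bar>F $ 4\<bar>) has_derivative
      (\<lambda>H. (- 1 / F $ 4) * H $ 2 + (1 / F $ 5) * H $ 3 + (F $ 2 / (F $ 4)\<^sup>2 + l / F $ 4) * H $ 4
        + (- (F $ 3 / (F $ 5)\<^sup>2) - 1 / F $ 5) * H $ 5)) (at F)"
    by (rule has_derivative_eq_rhs[OF has_derivative_add[OF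
          has_derivative_diff[OF has_derivative_ratio_difference[OF F]
            has_derivative_ln_abs[OF has_derivative_nth V_nonzero(2)[OF F]]]
          has_derivative_mult_right[OF has_derivative_ln_abs[OF has_derivative_nth V_nonzero(1)[OF F]]]]])
       (simp add: fun_eq_iff algebra_simps)
  show "F \<bullet> g10 l u (gradient (- 1 / F $ 4) (1 / F $ 5) (F $ 2 / (F $ 4)\<^sup>2 + l / F $ 4)
      (- (F $ 3 / (F $ 5)\<^sup>2) - 1 / F $ 5)) = 0" for u
    using V_nonzero[OF F] by (simp add: gmd_bracket_simps gradient_nth field_simps power2_eq_square)
  fix z assume h: "\<And>u. F \<bullet> g10 l u z = 0" and "z $ 2 = 0"
  then show "z = 0"
    using h[of "bv 1"] h[of "bv 2"] h[of "bv 3"] h[of "bv 4"] h[of "bv 5"] h[of "bv 6"] h[of "bv 7"]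
      V_nonzero[OF F] by (auto simp: gmd_bracket_simps vec_eq_iff forall_7)
qed (auto simp: set2_nth V_nonzero)

lemma gmd_invariant_exists: "br \<in> gmd_algebras \<Longrightarrow> \<exists>P. gmd_invariant br P"
  unfolding gmd_algebras_def
  using gmd_invariant_g2 gmd_invariant_g3 gmd_invariant_g4_00 gmd_invariant_g9 gmd_invariant_g10
  by blast

section \<open>The coadjoint orbits in V\<close>

lemma leaf_transversal:
  assumes "straightens P k" "H \<in> leaf P b" "H + t *\<^sub>R bv 2 \<in> leaf P b"
  shows "t = 0"
proof -
  have shift: "H + t *\<^sub>R bv 2 = set2 H (H $ 2 + t)"
    by (simp add: set2_def)
  have inj: "inj_on (\<lambda>F. set2 F (P F)) V"
    using assms(1) unfolding straightens_def homeomorphism_def by (metis inj_on_inverseI)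
  have "set2 H (P H) = set2 (set2 H (H $ 2 + t)) (P (set2 H (H $ 2 + t)))"
    using assms(2,3) by (auto simp: shift leaf_def set2_set2)
  then have "H = set2 H (H $ 2 + t)"
    by (rule inj_onD[OF inj]) (use assms(2) in \<open>auto simp: leaf_def set2_in_V\<close>)
  then have "H $ 2 = H $ 2 + t"
    using set2_nth[of H "H $ 2 + t" 2] by simp
  then show ?thesis by simp
qed

lemma leaf_nonempty:
  assumes "straightens P k" "i < 4"
  shows "leaf P (i, c) \<noteq> {}"
proof -
  let ?F = "(\<chi> j. if j = 2 then c else if j = 4 then sign4 i else if j = 5 then sign5 i else 0) :: real^7"
  have "?F \<in> {F. 0 < sign4 i * F $ 4 \<and> 0 < sign5 i * F $ 5}"
    by (simp add: sign4_def sign5_def)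
  then have "?F \<in> V" "quadrant ?F = i"
    using quadrant_component[OF assms(2)] by blast+
  then have "?F \<in> leaf (\<lambda>F. F $ 2) (i, c)"
    by (simp add: leaf_def)
  then show ?thesis
    using straightens_image_leaf(2)[OF assms(1)] by blast
qed

lemma quadrant_locally_constant:
  assumes F: "F \<in> V"
  shows "((\<lambda>H. real (quadrant H)) has_derivative (\<lambda>_. 0)) (at F)"
proof -
  have "open {H::real^7. 0 < H $ 4 * F $ 4 \<and> 0 < H $ 5 * F $ 5}"
    by (intro open_Collect_conj open_Collect_less continuous_intros)
  moreover have "F \<in> {H. 0 < H $ 4 * F $ 4 \<and> 0 < H $ 5 * F $ 5}"
    using V_nonzero[OF F] by (auto simp: zero_less_mult_iff)
  moreover have "real (quadrant F) = real (quadrant H)"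
    if "H \<in> {H. 0 < H $ 4 * F $ 4 \<and> 0 < H $ 5 * F $ 5}" for H
    using that by (auto simp: quadrant_def zero_less_mult_iff)
  ultimately show ?thesis
    by (rule has_derivative_transform_within_open[OF has_derivative_const])
qed

text \<open>\<open>X\<^sub>4\<close> and \<open>X\<^sub>5\<close> are common eigenvectors of the adjoint representation, so \<open>x\<^sub>4\<close> and \<open>x\<^sub>5\<close> are multiplied by
nonzero factors and the orbit stays in \<open>V\<close>. There \<open>P\<close> and the quadrant have zero derivative along the
orbit, which therefore stays in one leaf, and it fills the leaf since the leaf is connected.\<close>

lemma coadjoint_orbit_in_V:
  assumes group: "presented_lie_group G A \<iota> br" and P: "gmd_invariant br P" and F: "F \<in> V"
  shows "lie_group.coadjoint_orbit G A \<iota> F = leaf P (quadrant F, P F)"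
proof -
  interpret presented_lie_group G A \<iota> br
    by (rule group)
  obtain k where k: "straightens P k"
    using P by (auto simp: gmd_invariant_def)
  obtain D where D: "\<And>H. H \<in> V \<Longrightarrow> (P has_derivative (\<lambda>K. K \<bullet> D H)) (at H)"
    "\<And>H u. H \<in> V \<Longrightarrow> H \<bullet> br u (D H) = 0"
    using P unfolding gmd_invariant_def by metis
  have in_V: "coadj g H \<in> V" if g: "g \<in> carrier G" and H: "H \<in> V" for g H
  proof -
    have "coadj g H $ j \<noteq> 0" if j: "j \<in> {4, 5}" for j
    proof -
      obtain a where "\<And>u. br u (bv j) = a u *\<^sub>R bv j"
        using P j unfolding gmd_invariant_def by blast
      then obtain c where "c \<noteq> 0" "coadj g H \<bullet> bv j = c * (H \<bullet> bv j)"
        using coadj_eigenform[of "bv j" a g] g by (auto simp: axis_eq_0_iff)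
      then show ?thesis
        using j H by (auto simp: inner_axis V_def)
    qed
    then show ?thesis by (simp add: V_def)
  qed
  have P_invariant: "P (coadj g H) = P H" if "g \<in> carrier G" "H \<in> V" for g H
    by (rule coadj_invariant[where D = "\<lambda>h K. K \<bullet> D (coadj h H)"])
       (use that in \<open>auto simp: D in_V coad_field_inner\<close>)
  have quadrant_invariant: "quadrant (coadj g H) = quadrant H" if "g \<in> carrier G" "H \<in> V" for g H
  proof -
    \<comment> \<open>The number of the quadrant, as a real function, is locally constant on \<open>V\<close>; so it is an invariant
      of the same kind as \<open>P\<close>.\<close>
    have "real (quadrant (coadj g H)) = real (quadrant H)"
      by (rule coadj_invariant[where D = "\<lambda>_ _. 0"])
         (use that in \<open>auto intro: quadrant_locally_constant in_V\<close>)
    then show ?thesis by simp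
  qed
  show ?thesis
  proof (rule coadjoint_orbit_eq_leaf[where n = "bv 2"])
    show "connected (leaf P (quadrant F, P F))"
      by (rule connected_leaf[OF k quadrant_less])
    show "F \<in> leaf P (quadrant F, P F)"
      using F by (simp add: leaf_def)
    show "coadj g H \<in> leaf P (quadrant F, P F)"
      if "g \<in> carrier G" "H \<in> leaf P (quadrant F, P F)" for g H
      using that in_V P_invariant quadrant_invariant by (auto simp: leaf_def)
    show "z = 0" if "H \<in> leaf P (quadrant F, P F)" "\<And>u. H \<bullet> br u z = 0" "bv 2 \<bullet> z = 0" for H z
      using that P unfolding gmd_invariant_def leaf_def by (auto simp: inner_axis')
  qed (rule leaf_transversal[OF k])
qed

lemma gmd_foliation_eq:
  assumes group: "gmd_group G A \<iota> br" and P: "gmd_invariant br P"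
  shows "gmd_foliation G A \<iota> = (V, leaf P ` topspace four_lines)"
proof -
  have "presented_lie_group G A \<iota> br"
    using group by (auto simp: gmd_group_def presented_lie_group_def presented_lie_group_axioms_def
        connected_lie_group_def connected_lie_group_axioms_def)
  then have orbit: "lie_group.coadjoint_orbit G A \<iota> F = leaf P (quadrant F, P F)" if "F \<in> V" for F
    by (rule coadjoint_orbit_in_V[OF _ P that])
  obtain k where k: "straightens P k"
    using P by (auto simp: gmd_invariant_def)
  have "{lie_group.coadjoint_orbit G A \<iota> F | F. F \<in> V} = leaf P ` topspace four_lines"
  proof (intro equalityI subsetI)
    fix L assume "L \<in> {lie_group.coadjoint_orbit G A \<iota> F | F. F \<in> V}"
    then obtain F where "F \<in> V" "L = lie_group.coadjoint_orbit G A \<iota> F"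
      by blast
    then have "L = leaf P (quadrant F, P F)"
      using orbit by simp
    then show "L \<in> leaf P ` topspace four_lines"
      by (simp add: topspace_four_lines quadrant_less)
  next
    fix L assume "L \<in> leaf P ` topspace four_lines"
    then obtain i c where L: "i < 4" "L = leaf P (i, c)"
      by (auto simp: topspace_four_lines)
    then obtain F where "F \<in> leaf P (i, c)"
      using leaf_nonempty[OF k] by blast
    then have "F \<in> V" "L = lie_group.coadjoint_orbit G A \<iota> F"
      using orbit[of F] L by (auto simp: leaf_def)
    then show "L \<in> {lie_group.coadjoint_orbit G A \<iota> F | F. F \<in> V}"
      by blast
  qed
  then show ?thesis
    by (simp add: gmd_foliation_def)
qed

theorem theorem3p8:
  fixes G :: "'g::{t2_space, second_countable_topology} monoid"
    and A :: "('g set \<times> ('g \<Rightarrow> 'a::euclidean_space)) set"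
    and \<iota> :: "real^7 \<Rightarrow> 'a"
    and br :: "real^7 \<Rightarrow> real^7 \<Rightarrow> real^7"
    and G' :: "'h::{t2_space, second_countable_topology} monoid"
    and A' :: "('h set \<times> ('h \<Rightarrow> 'b::euclidean_space)) set"
    and \<iota>' :: "real^7 \<Rightarrow> 'b"
    and br' :: "real^7 \<Rightarrow> real^7 \<Rightarrow> real^7"
  assumes G: "gmd_group G A \<iota> br"
    and G': "gmd_group G' A' \<iota>' br'"
  shows "topologically_equivalent (gmd_foliation G A \<iota>) (gmd_foliation G' A' \<iota>') \<and>
         (\<exists>p. trivial_fibration (top_of_set V) four_lines p \<and>
           (\<forall>b \<in> topspace four_lines. connected {F \<in> V. p F = b}) \<and>
           snd (gmd_foliation G A \<iota>) = {{F \<in> V. p F = b} | b. b \<in> topspace four_lines})"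
proof -
  obtain P P' where P: "gmd_invariant br P" and P': "gmd_invariant br' P'"
    using G G' gmd_invariant_exists unfolding gmd_group_def by metis
  then obtain k k' where k: "straightens P k" and k': "straightens P' k'"
    by (auto simp: gmd_invariant_def)
  have "topologically_equivalent (gmd_foliation G A \<iota>) (gmd_foliation G' A' \<iota>')"
    unfolding gmd_foliation_eq[OF G P] gmd_foliation_eq[OF G' P']
    by (rule straightened_foliations_equivalent[OF k k'])
  moreover have "trivial_fibration (top_of_set V) four_lines (\<lambda>F. (quadrant F, P F))"
    by (rule straightened_trivial_fibration[OF k])
  moreover have "\<forall>b \<in> topspace four_lines. connected {F \<in> V. (quadrant F, P F) = b}"
    using connected_leaf[OF k] by (auto simp: topspace_four_lines leaf_def)
  moreover have "snd (gmd_foliation G A \<iota>) =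
      {{F \<in> V. (quadrant F, P F) = b} | b. b \<in> topspace four_lines}"
    by (auto simp: gmd_foliation_eq[OF G P] leaf_def)
  ultimately show ?thesis
    by blast
qed

end
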